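(* Let $\ell\ge2$ and let $\mathcal{A}_G$ be the graphic arrangement in $\mathbb{K}^\ell$ of a simple graph $G$ with vertex set $[\ell]=\{1,\dots,\ell\}$. Then $$\mathrm{pd}_S\,\Omega^1(\mathcal{A}_G)\le\frac{\ell}{2}-1.$$
   Context: Let $\mathbb{K}$ be a field, $V=\mathbb{K}^\ell$ and $S=\mathbb{K}[x_1,\dots,x_\ell]$, where $x_1,\dots,x_\ell$ are the coordinate functions. For a simple graph $G$ with vertex set $[\ell]$ and edge set $E(G)$, the graphic arrangement is $\mathcal{A}_G=\{\{x_u=x_v\}\mid\{u,v\}\in E(G)\}$. For a finite set $\mathcal{A}$ of linear hyperplanes in $V$, $\alpha_H\in V^*$ denotes a defining linear form of $H\in\mathcal{A}$ and $Q(\mathcal{A})=\prod_{H\in\mathcal{A}}\alpha_H$. Let $\Omega_V^1=\bigoplus_i S\,dx_i$, $\Omega_V^2=\bigwedge^2\Omega_V^1$, and for $\alpha=\sum c_ix_i$ let $d\alpha=\sum c_i\,dx_i$. Define $$\Omega^1(\mathcal{A})=\{\omega\in \tfrac{1}{Q(\mathcal{A})}\Omega^1_V \mid Q(\mathcal{A})\,\omega\wedge d\alpha_H\in\alpha_H\Omega_V^2\ \text{for all } H\in\mathcal{A}\}.$$ $\mathrm{pd}_S$ denotes projective dimension over $S$. *)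

theory Defs
  imports
    "HOL-Library.Poly_Mapping"
    "HOL-Library.Extended_Real"
    "HOL-Computational_Algebra.Polynomial_Factorial"
    "HOL-Algebra.Module"
begin

section \<open>Projective dimension\<close>

definition linear_maps ::
  "'r ring \<Rightarrow> ('r, 'm) module \<Rightarrow> ('r, 'n) module \<Rightarrow> ('m \<Rightarrow> 'n) set" where
  "linear_maps R M N =
     {f. (\<forall>x\<in>carrier M. f x \<in> carrier N) \<and>
         (\<forall>x\<in>carrier M. \<forall>y\<in>carrier M. f (x \<oplus>\<^bsub>M\<^esub> y) = f x \<oplus>\<^bsub>N\<^esub> f y) \<and>
         (\<forall>a\<in>carrier R. \<forall>x\<in>carrier M. f (a \<odot>\<^bsub>M\<^esub> x) = a \<odot>\<^bsub>N\<^esub> f x)}"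

definition free_module :: "'r ring \<Rightarrow> 'i set \<Rightarrow> ('r, 'i \<Rightarrow> 'r) module" where
  "free_module R I =
     \<lparr>carrier = {f. (\<forall>i\<in>I. f i \<in> carrier R) \<and> (\<forall>i. i \<notin> I \<longrightarrow> f i = \<zero>\<^bsub>R\<^esub>) \<and>
                    finite {i. f i \<noteq> \<zero>\<^bsub>R\<^esub>}},
      mult = undefined, one = undefined,
      zero = (\<lambda>i. \<zero>\<^bsub>R\<^esub>), add = (\<lambda>f g i. f i \<oplus>\<^bsub>R\<^esub> g i),
      smult = (\<lambda>a f i. a \<otimes>\<^bsub>R\<^esub> f i)\<rparr>"

text \<open>
  A module is projective if it is isomorphic to a direct summand of a free module, that is, a
  retract of some free module.  Index sets inside the type of the elements of \<open>P\<close> are enough: a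
  retract of any free module is also a retract of the free module on the set \<open>carrier P\<close>.
\<close>

definition projective_module :: "'r ring \<Rightarrow> ('r, 'm) module \<Rightarrow> bool" where
  "projective_module R P \<longleftrightarrow>
     module R P \<and>
     (\<exists>(I :: 'm set). \<exists>s \<in> linear_maps R P (free_module R I).
        \<exists>p \<in> linear_maps R (free_module R I) P. \<forall>x\<in>carrier P. p (s x) = x)"

text \<open>
  \<open>proj_resolution R M n P d e\<close>: the sequence
  \<open>0 \<rightarrow> P n \<rightarrow> \<dots> \<rightarrow> P 1 \<rightarrow> P 0 \<rightarrow> M \<rightarrow> 0\<close> with maps \<open>d i : P (i + 1) \<rightarrow> P i\<close> and \<open>e : P 0 \<rightarrow> M\<close>
  is exact, and the \<open>P i\<close> are projective; it is continued by zero modules to the left.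
\<close>

definition proj_resolution ::
  "'r ring \<Rightarrow> ('r, 'm) module \<Rightarrow> nat \<Rightarrow> (nat \<Rightarrow> ('r, 'c) module) \<Rightarrow>
     (nat \<Rightarrow> 'c \<Rightarrow> 'c) \<Rightarrow> ('c \<Rightarrow> 'm) \<Rightarrow> bool" where
  "proj_resolution R M n P d e \<longleftrightarrow>
     (\<forall>i. projective_module R (P i)) \<and>
     (\<forall>i>n. carrier (P i) = {\<zero>\<^bsub>P i\<^esub>}) \<and>
     (\<forall>i. d i \<in> linear_maps R (P (Suc i)) (P i)) \<and>
     e \<in> linear_maps R (P 0) M \<and>
     e ` carrier (P 0) = carrier M \<and>
     d 0 ` carrier (P 1) = {x \<in> carrier (P 0). e x = \<zero>\<^bsub>M\<^esub>} \<and>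
     (\<forall>i. d (Suc i) ` carrier (P (Suc (Suc i))) =
            {x \<in> carrier (P (Suc i)). d i x = \<zero>\<^bsub>P i\<^esub>})"

text \<open>
  The infimum of the lengths of the projective resolutions of \<open>M\<close>, which is \<open>\<infinity>\<close> if there is no
  finite one (the zero module gets \<open>0\<close>).  HOL cannot quantify over the type of the
  elements of the \<open>P i\<close>, so it is fixed, but this does not restrict the resolutions: with
  \<open>\<kappa> = max (\<aleph>\<^sub>0, |R|, |M|)\<close>, the index type \<open>nat + 'r + 'm\<close> has at least \<open>\<kappa>\<close>
  elements, so the type below contains a free module of rank \<open>\<kappa>\<close> and all its submodules.  This
  is enough for the free covers of \<open>M\<close> and of its successive syzygies (all of cardinality at most
  \<open>\<kappa>\<close>), and if \<open>M\<close> has any projective resolution of length \<open>n\<close>, then the \<open>n\<close>-th syzygy so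
  obtained is projective.
\<close>

definition proj_dim :: "'r ring \<Rightarrow> ('r, 'm) module \<Rightarrow> enat" where
  "proj_dim R M =
     Inf {enat n | n. \<exists>(P :: nat \<Rightarrow> ('r, nat + 'r + 'm \<Rightarrow> 'r) module) d e.
                        proj_resolution R M n P d e}"

section \<open>Polynomials and differential forms\<close>

text \<open>
  \<open>poly_ring l\<close> is the ring in the variables with indices in \<open>{1..l}\<close>, as a subring of the
  polynomials in variables indexed by \<^typ>\<open>nat\<close>; a monomial is its exponent function.
\<close>

type_synonym 'k mpoly = "(nat \<Rightarrow>\<^sub>0 nat) \<Rightarrow>\<^sub>0 'k"

definition poly_ring :: "nat \<Rightarrow> 'k::field mpoly ring" where
  "poly_ring l =
     \<lparr>carrier = {p. \<forall>m\<in>Poly_Mapping.keys p. Poly_Mapping.keys m \<subseteq> {1..l}},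
      mult = (*), one = 1, zero = 0, add = (+)\<rparr>"

definition Var :: "nat \<Rightarrow> 'k::field mpoly" where
  "Var i = Poly_Mapping.single (Poly_Mapping.single i 1) 1"

definition Const :: "'k::field \<Rightarrow> 'k mpoly" where
  "Const c = Poly_Mapping.single 0 c"

text \<open>
  A rational 1-form \<open>\<Sum>i. f\<^sub>i dx\<^sub>i\<close> is the function \<open>i \<mapsto> f\<^sub>i\<close>, and a rational 2-form
  \<open>\<Sum>i<j. f\<^sub>i\<^sub>j dx\<^sub>i \<and> dx\<^sub>j\<close> is the function \<open>(i, j) \<mapsto> f\<^sub>i\<^sub>j\<close>; both are \<open>0\<close> outside of the basis indices.
\<close>

type_synonym 'k form1 = "nat \<Rightarrow> 'k mpoly fract"
type_synonym 'k form2 = "nat \<times> nat \<Rightarrow> 'k mpoly fract"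

definition poly_forms1 :: "nat \<Rightarrow> 'k::field form1 set" where
  "poly_forms1 l =
     {\<omega>. \<forall>i. if i \<in> {1..l} then \<omega> i \<in> to_fract ` carrier (poly_ring l) else \<omega> i = 0}"

definition poly_forms2 :: "nat \<Rightarrow> 'k::field form2 set" where
  "poly_forms2 l =
     {\<theta>. \<forall>i j. if 1 \<le> i \<and> i < j \<and> j \<le> l then \<theta> (i, j) \<in> to_fract ` carrier (poly_ring l)
               else \<theta> (i, j) = 0}"

definition form_scale :: "'a::times \<Rightarrow> ('i \<Rightarrow> 'a) \<Rightarrow> 'i \<Rightarrow> 'a" where
  "form_scale f \<omega> = (\<lambda>i. f * \<omega> i)"

definition wedge :: "'k::field form1 \<Rightarrow> 'k form1 \<Rightarrow> 'k form2" where
  "wedge \<omega> \<eta> = (\<lambda>(i, j). if i < j then \<omega> i * \<eta> j - \<omega> j * \<eta> i else 0)"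

section \<open>Arrangements and logarithmic 1-forms\<close>

definition coord_space :: "nat \<Rightarrow> (nat \<Rightarrow> 'k::field) set" where
  "coord_space l = {v. \<forall>i. i \<notin> {1..l} \<longrightarrow> v i = 0}"

text \<open>The linear form \<open>\<Sum>i. c\<^sub>i x\<^sub>i\<close> is given by its coefficient vector \<open>c\<close>.\<close>

definition defining_form :: "nat \<Rightarrow> (nat \<Rightarrow> 'k::field) set \<Rightarrow> (nat \<Rightarrow> 'k) \<Rightarrow> bool" where
  "defining_form l H c \<longleftrightarrow>
     c \<in> coord_space l \<and> c \<noteq> (\<lambda>i. 0) \<and>
     H = {v \<in> coord_space l. (\<Sum>i\<in>{1..l}. c i * v i) = 0}"

definition form_poly :: "nat \<Rightarrow> (nat \<Rightarrow> 'k::field) \<Rightarrow> 'k mpoly" where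
  "form_poly l c = (\<Sum>i\<in>{1..l}. Const (c i) * Var i)"

definition form_diff :: "nat \<Rightarrow> (nat \<Rightarrow> 'k::field) \<Rightarrow> 'k form1" where
  "form_diff l c = (\<lambda>i. if i \<in> {1..l} then to_fract (Const (c i)) else 0)"

text \<open>In the following, \<open>\<alpha> H\<close> is the chosen defining form of \<open>H\<close>.\<close>

definition defining_poly ::
  "nat \<Rightarrow> (nat \<Rightarrow> 'k::field) set set \<Rightarrow> ((nat \<Rightarrow> 'k) set \<Rightarrow> nat \<Rightarrow> 'k) \<Rightarrow> 'k mpoly" where
  "defining_poly l A \<alpha> = (\<Prod>H\<in>A. form_poly l (\<alpha> H))"

definition log_forms ::
  "nat \<Rightarrow> (nat \<Rightarrow> 'k::field) set set \<Rightarrow> ((nat \<Rightarrow> 'k) set \<Rightarrow> nat \<Rightarrow> 'k) \<Rightarrow> 'k form1 set" where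
  "log_forms l A \<alpha> =
     {\<omega> \<in> form_scale (1 / to_fract (defining_poly l A \<alpha>)) ` poly_forms1 l.
        \<forall>H\<in>A. wedge (form_scale (to_fract (defining_poly l A \<alpha>)) \<omega>) (form_diff l (\<alpha> H))
               \<in> form_scale (to_fract (form_poly l (\<alpha> H))) ` poly_forms2 l}"

definition log_module ::
  "nat \<Rightarrow> (nat \<Rightarrow> 'k::field) set set \<Rightarrow> ((nat \<Rightarrow> 'k) set \<Rightarrow> nat \<Rightarrow> 'k) \<Rightarrow>
     ('k mpoly, 'k form1) module" where
  "log_module l A \<alpha> =
     \<lparr>carrier = log_forms l A \<alpha>, mult = undefined, one = undefined,
      zero = (\<lambda>i. 0), add = (\<lambda>\<omega> \<eta> i. \<omega> i + \<eta> i),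
      smult = (\<lambda>p. form_scale (to_fract p))\<rparr>"

definition graphic_arrangement :: "nat \<Rightarrow> nat set set \<Rightarrow> (nat \<Rightarrow> 'k::field) set set" where
  "graphic_arrangement l E = {{x \<in> coord_space l. x u = x v} | u v. {u, v} \<in> E}"

text \<open>\<open>E\<close> is the edge set of a simple graph with vertex set \<open>{1..l}\<close>.\<close>

definition simple_graph :: "nat \<Rightarrow> nat set set \<Rightarrow> bool" where
  "simple_graph l E \<longleftrightarrow> (\<forall>e\<in>E. e \<subseteq> {1..l} \<and> card e = 2)"

end

(*
  Fix a vertex v with neighbourhood N, and let G - v be the graph without v.  Sending a logarithmic
  form to its dx_v-coefficient has kernel the logarithmic forms of G - v, and its image is, up to a
  common denominator, the ideal of the polynomials that vanish on x_u = x_w = x_v for all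
  non-adjacent u, w in N.  In the coordinates x_u - x_v this is the vertex cover ideal of the
  complement of G[N].

  For the cover ideal J(H) of a graph H with variables y_u, and m the product of the variables of
  the neighbours of u, one has J(H) = y_u J(H - u) + m J(H - N[u]), and the two summands intersect in
  y_u m J(H - N[u]).  So pd J(H) <= max (pd J(H - u), 1 + pd J(H - N[u])), and each increase costs two
  vertices: pd J(H) <= |H| / 2.

  If G is not complete, v can be chosen with degree at most l - 2, and if it is complete, the image
  is free.  Induction on the number of vertices gives the bound.
*)

theory Submission
  imports Defs
begin

section \<open>Finite free resolutions\<close>

text \<open>The homological part works with explicit finite free resolutions and two rules for them,
  one for extensions and one for a sum of two submodules. The ring stays \<open>R\<close>, in all l
  variables, when vertices are removed, so the log forms of all induced subgraphs and all cover
  ideals are modules over one ring.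

  The divisibility arguments rest on one device: divisibility by x_a - x_b is vanishing after x_a is
  replaced by x_b, so these forms are prime because the substitution is a homomorphism into a
  domain.

  The overview leaves open why the image is the whole ideal. The dx_v-coefficient of a numerator is
  \<open>Q * g\<close> with \<open>Q\<close> the product over the edges that avoid v; the common
  denominator is the product of x_v - x_u over u in N. Comparing the conditions at two edges v u and
  v w with u, w not adjacent forces g to vanish on x_u = x_w = x_v. Conversely, such a g has to be
  completed by coefficients of the other dx_u. Partial fractions in x_v supply them, and the
  vanishing of g cancels their poles along x_u = x_w.\<close>

definition lin_comb :: "nat \<Rightarrow> (nat \<Rightarrow> 'i \<Rightarrow> 'a::comm_ring_1) \<Rightarrow> (nat \<Rightarrow> 'a) \<Rightarrow> 'i \<Rightarrow> 'a" where
  "lin_comb k g x = (\<lambda>j. \<Sum>i<k. x i * g i j)"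

text \<open>The number l is a variable of the theorem and a type cannot depend on it. So S is a
  subset \<open>R\<close> of the type of polynomials in all variables, and modules over
  \<open>R\<close> are sets of functions.\<close>

locale scalars =
  fixes R :: "'a::comm_ring_1 set"
  assumes zero_R [simp]: "0 \<in> R" and one_R [simp]: "1 \<in> R"
    and add_R [simp]: "a \<in> R \<Longrightarrow> b \<in> R \<Longrightarrow> a + b \<in> R"
    and mult_R [simp]: "a \<in> R \<Longrightarrow> b \<in> R \<Longrightarrow> a * b \<in> R"
    and uminus_R [simp]: "a \<in> R \<Longrightarrow> - a \<in> R"
begin

lemma diff_R [simp]: "a \<in> R \<Longrightarrow> b \<in> R \<Longrightarrow> a - b \<in> R"
  using add_R[of a "- b"] by simp

lemma prod_R: "(\<And>i. i \<in> I \<Longrightarrow> f i \<in> R) \<Longrightarrow> prod f I \<in> R"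
  by (induction I rule: infinite_finite_induct) auto

definition submod :: "('i \<Rightarrow> 'a) set \<Rightarrow> bool" where
  "submod M \<longleftrightarrow> (\<lambda>_. 0) \<in> M \<and> (\<forall>x\<in>M. \<forall>y\<in>M. (\<lambda>i. x i + y i) \<in> M) \<and>
     (\<forall>a\<in>R. \<forall>x\<in>M. (\<lambda>i. a * x i) \<in> M)"

definition linear_on :: "('i \<Rightarrow> 'a) set \<Rightarrow> (('i \<Rightarrow> 'a) \<Rightarrow> 'j \<Rightarrow> 'a) \<Rightarrow> bool" where
  "linear_on M f \<longleftrightarrow> (\<forall>x\<in>M. \<forall>y\<in>M. f (\<lambda>i. x i + y i) = (\<lambda>i. f x i + f y i)) \<and>
     (\<forall>a\<in>R. \<forall>x\<in>M. f (\<lambda>i. a * x i) = (\<lambda>i. a * f x i))"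

definition free :: "nat \<Rightarrow> (nat \<Rightarrow> 'a) set" where
  "free k = {x. (\<forall>i<k. x i \<in> R) \<and> (\<forall>i\<ge>k. x i = 0)}"

definition syz :: "nat \<Rightarrow> (nat \<Rightarrow> 'i \<Rightarrow> 'a) \<Rightarrow> (nat \<Rightarrow> 'a) set" where
  "syz k g = {x \<in> free k. lin_comb k g x = (\<lambda>_. 0)}"

text \<open>\<open>pd_less n M\<close>: \<open>M\<close> has a resolution of length less than \<open>n\<close> by finitely generated free modules.
  Syzygies of submodules of \<open>nat \<Rightarrow> 'a\<close> are again of this type, which makes the recursion possible.\<close>

fun pd_less :: "nat \<Rightarrow> (nat \<Rightarrow> 'a) set \<Rightarrow> bool" where
  "pd_less 0 M = (M = {\<lambda>_. 0})"
| "pd_less (Suc n) M = (\<exists>k g. lin_comb k g ` free k = M \<and> pd_less n (syz k g))"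

lemma pd_less_SucI: "lin_comb k g ` free k = M \<Longrightarrow> pd_less n (syz k g) \<Longrightarrow> pd_less (Suc n) M"
  by auto

lemma pd_less_SucE:
  assumes "pd_less (Suc n) M"
  obtains k g where "lin_comb k g ` free k = M" "pd_less n (syz k g)"
  using assms by auto

declare pd_less.simps(2) [simp del]

lemma submod_zero: "submod M \<Longrightarrow> (\<lambda>_. 0) \<in> M"
  and submod_add: "submod M \<Longrightarrow> x \<in> M \<Longrightarrow> y \<in> M \<Longrightarrow> (\<lambda>i. x i + y i) \<in> M"
  and submod_smult: "submod M \<Longrightarrow> a \<in> R \<Longrightarrow> x \<in> M \<Longrightarrow> (\<lambda>i. a * x i) \<in> M"
  by (auto simp: submod_def)

lemma submod_uminus: "submod M \<Longrightarrow> x \<in> M \<Longrightarrow> (\<lambda>i. - x i) \<in> M"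
  using submod_smult[of M "- 1" x] by simp

lemma submod_diff: "submod M \<Longrightarrow> x \<in> M \<Longrightarrow> y \<in> M \<Longrightarrow> (\<lambda>i. x i - y i) \<in> M"
  using submod_add[of M x, OF _ _ submod_uminus[of M y]] by simp

lemma linear_onD:
  assumes "linear_on M f"
  shows "x \<in> M \<Longrightarrow> y \<in> M \<Longrightarrow> f (\<lambda>i. x i + y i) = (\<lambda>i. f x i + f y i)"
    and "a \<in> R \<Longrightarrow> x \<in> M \<Longrightarrow> f (\<lambda>i. a * x i) = (\<lambda>i. a * f x i)"
  using assms by (auto simp: linear_on_def)

lemma linear_on_zero:
  assumes "linear_on M f" "submod M"
  shows "f (\<lambda>_. 0) = (\<lambda>_. 0)"
  using linear_onD(2)[OF assms(1), of 0 "\<lambda>_. 0"] submod_zero[OF assms(2)] by simp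

lemma linear_on_diff:
  assumes "linear_on M f" "submod M" "x \<in> M" "y \<in> M"
  shows "f (\<lambda>i. x i - y i) = (\<lambda>i. f x i - f y i)"
  using linear_onD(1)[OF assms(1), of x "\<lambda>i. - y i"] linear_onD(2)[OF assms(1), of "- 1" y]
    submod_uminus[OF assms(2), of y] assms by simp

lemma freeD: "x \<in> free k \<Longrightarrow> x i \<in> R"
  unfolding free_def by (cases "i < k") auto

lemma submod_free: "submod (free k)"
  by (auto simp: submod_def free_def)

lemma lin_comb_add: "lin_comb k g (\<lambda>i. x i + y i) = (\<lambda>j. lin_comb k g x j + lin_comb k g y j)"
  by (simp add: lin_comb_def algebra_simps sum.distrib)

lemma lin_comb_smult: "lin_comb k g (\<lambda>i. a * x i) = (\<lambda>j. a * lin_comb k g x j)"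
  by (simp add: lin_comb_def algebra_simps sum_distrib_left)

lemma lin_comb_cong: "(\<And>i. i < k \<Longrightarrow> x i = y i) \<Longrightarrow> (\<And>i. i < k \<Longrightarrow> g i = h i) \<Longrightarrow>
    lin_comb k g x = lin_comb k h y"
  by (simp add: lin_comb_def)

lemma lin_comb_zero [simp]: "lin_comb k g (\<lambda>_. 0) = (\<lambda>_. 0)"
  by (simp add: lin_comb_def)

lemma submod_syz: "submod (syz k g)"
  using submod_free[of k]
  by (auto simp: submod_def syz_def lin_comb_add lin_comb_smult)

lemma linear_on_lin_comb: "linear_on M (lin_comb k g)"
  by (simp add: linear_on_def lin_comb_add lin_comb_smult)

lemma generator_mem:
  assumes "lin_comb k g ` free k = M" "i < k"
  shows "g i \<in> M"
proof -
  let ?u = "\<lambda>j. if j = i then 1 else (0 :: 'a)"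
  have "(\<Sum>j<k. ?u j * g j t) = (\<Sum>j<k. if j = i then g j t else 0)" for t
    by (rule sum.cong) auto
  then have "lin_comb k g ?u = g i"
    using assms(2) by (simp add: lin_comb_def)
  moreover have "?u \<in> free k"
    using assms(2) by (auto simp: free_def)
  ultimately show ?thesis
    using assms(1) imageI[of ?u "free k" "lin_comb k g"] by simp
qed

lemma lin_comb_mem:
  assumes "submod M" "\<And>i. i < k \<Longrightarrow> g i \<in> M" "\<And>i. i < k \<Longrightarrow> x i \<in> R"
  shows "lin_comb k g x \<in> M"
  using assms(2,3)
proof (induction k)
  case 0
  then show ?case using submod_zero[OF assms(1)] by (simp add: lin_comb_def)
next
  case (Suc k)
  have "(\<lambda>j. lin_comb k g x j + x k * g k j) \<in> M"
    using Suc by (intro submod_add[OF assms(1)] submod_smult[OF assms(1)]) auto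
  then show ?case by (simp add: lin_comb_def)
qed

lemma linear_on_image_lin_comb:
  assumes "submod M" "linear_on M f" "\<And>i. i < k \<Longrightarrow> g i \<in> M" "\<And>i. i < k \<Longrightarrow> x i \<in> R"
  shows "f (lin_comb k g x) = lin_comb k (\<lambda>i. f (g i)) x"
  using assms(3,4)
proof (induction k)
  case 0
  then show ?case using linear_on_zero[OF assms(2,1)] by (simp add: lin_comb_def)
next
  case (Suc k)
  have "f (\<lambda>j. lin_comb k g x j + x k * g k j) = (\<lambda>j. f (lin_comb k g x) j + x k * f (g k) j)"
    using Suc.prems
    by (subst linear_onD[OF assms(2)] lin_comb_mem[OF assms(1)] submod_smult[OF assms(1)] | simp)+
  then show ?case using Suc by (simp add: lin_comb_def)
qed

text \<open>A resolution may be prolonged by zero modules: the empty family generates the zero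
  module and has only the zero syzygy.\<close>

lemma pd_less_Suc: "pd_less n M \<Longrightarrow> pd_less (Suc n) M"
proof (induction n arbitrary: M)
  case 0
  have "lin_comb 0 g ` free 0 = M" "syz 0 g = {\<lambda>_. 0}" for g :: "nat \<Rightarrow> nat \<Rightarrow> 'a"
    using 0 by (auto simp: free_def lin_comb_def syz_def image_def)
  then show ?case by (metis pd_less_SucI pd_less.simps(1))
next
  case (Suc n)
  then show ?case by (metis pd_less.simps(2))
qed

lemma pd_less_mono: "pd_less n M \<Longrightarrow> n \<le> m \<Longrightarrow> pd_less m M"
proof (induction m)
  case (Suc m)
  then show ?case using pd_less_Suc by (cases "n = Suc m") auto
qed simp

text \<open>The images of the generators have the same set of syzygies, so the resolution is kept
  and only its augmentation is composed with f.\<close>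

lemma pd_less_iso:
  assumes "submod M" "linear_on M f" "inj_on f M" "pd_less n M"
  shows "pd_less n (f ` M)"
proof (cases n)
  case 0
  then show ?thesis using assms linear_on_zero by auto
next
  case (Suc m)
  then obtain k g where g: "lin_comb k g ` free k = M" "pd_less m (syz k g)"
    using assms(4) pd_less_SucE by metis
  note gM = generator_mem[OF g(1)]
  have f: "f (lin_comb k g x) = lin_comb k (\<lambda>i. f (g i)) x" if "x \<in> free k" for x
    using linear_on_image_lin_comb[OF assms(1,2), of k g x] gM freeD[OF that] by simp
  have "lin_comb k (\<lambda>i. f (g i)) x = (\<lambda>_. 0) \<longleftrightarrow> lin_comb k g x = (\<lambda>_. 0)" if "x \<in> free k" for x
    using f[OF that] linear_on_zero[OF assms(2,1)] inj_onD[OF assms(3), of "lin_comb k g x" "\<lambda>_. 0"]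
      g(1) that submod_zero[OF assms(1)] by auto
  then have "syz k (\<lambda>i. f (g i)) = syz k g"
    by (auto simp: syz_def)
  moreover have "lin_comb k (\<lambda>i. f (g i)) ` free k = f ` M"
    using f g(1) by force
  ultimately show ?thesis using Suc g(2) pd_less_SucI by metis
qed

section \<open>Resolutions of extensions and of sums of submodules\<close>

definition shift :: "nat \<Rightarrow> (nat \<Rightarrow> 'a) \<Rightarrow> nat \<Rightarrow> 'a" where
  "shift k x = (\<lambda>i. x (i + k))"

text \<open>Polymorphic because the same concatenation serves coefficient vectors and families of
  generators.\<close>

definition join :: "nat \<Rightarrow> (nat \<Rightarrow> 'b) \<Rightarrow> (nat \<Rightarrow> 'b) \<Rightarrow> nat \<Rightarrow> 'b" where
  "join k x y = (\<lambda>i. if i < k then x i else y (i - k))"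

lemma linear_on_shift: "linear_on M (shift k)"
  by (simp add: linear_on_def shift_def)

lemma shift_join [simp]: "shift k (join k x y) = y"
  by (simp add: shift_def join_def)

lemma join_mem_free: "x \<in> free k \<Longrightarrow> y \<in> free m \<Longrightarrow> join k x y \<in> free (k + m)"
  by (auto simp: free_def join_def)

lemma shift_mem_free: "x \<in> free (k + m) \<Longrightarrow> shift k x \<in> free m"
  by (auto simp: free_def shift_def)

lemma lin_comb_join:
  "lin_comb (k + m) (join k a b) x = (\<lambda>j. lin_comb k a x j + lin_comb m b (shift k x) j)"
proof -
  have "(\<Sum>i<k + m. h i) = (\<Sum>i<k. h i) + (\<Sum>i<m. h (i + k))" for h :: "nat \<Rightarrow> 'a"
    by (induction m) (auto simp: algebra_simps)
  then show ?thesis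
    by (simp add: lin_comb_def join_def shift_def)
qed

lemma lin_comb_join_left [simp]: "lin_comb k a (join k x y) = lin_comb k a x"
  by (rule lin_comb_cong) (auto simp: join_def)

lemma shift_eq_zero:
  assumes "shift k x = (\<lambda>_. 0)" "x \<in> free (k + m)"
  shows "x \<in> free k"
proof -
  have "x i = 0" if "i \<ge> k" for i
    using fun_cong[OF assms(1), of "i - k"] that by (simp add: shift_def)
  then show ?thesis using assms(2) by (auto simp: free_def)
qed

lemma free_mono: "x \<in> free k \<Longrightarrow> x \<in> free (k + m)"
  using freeD[of x k] by (simp add: free_def)

lemma shift_free: "x \<in> free k \<Longrightarrow> shift k x = (\<lambda>_. 0)"
  by (auto simp: free_def shift_def)

text \<open>A relation between the combined generators without a b-part is a relation between the
  a's. This is the kernel in both uses of the projection \<open>shift k\<close> below.\<close>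

lemma syz_join_shift_eq_zero: "{x \<in> syz (k + m) (join k a b). shift k x = (\<lambda>_. 0)} = syz k a"
proof -
  have "x \<in> syz (k + m) (join k a b) \<and> shift k x = (\<lambda>_. 0) \<longleftrightarrow> x \<in> syz k a" for x
    using shift_eq_zero[of k x m] free_mono[of x k m] shift_free[of x k]
    by (cases "shift k x = (\<lambda>_. 0)") (auto simp: syz_def lin_comb_join)
  then show ?thesis by blast
qed

text \<open>The horseshoe lemma. Generators a of the kernel and lifts b of generators c of the image
  together generate B, and projecting their syzygies to the b-part exhibits these as an extension of
  \<open>syz m c\<close> by \<open>syz k a\<close>. This is the same situation one step further on,
  with \<open>shift k\<close> in place of h, which is why B and h vary in the induction.\<close>

lemma pd_less_extension:
  assumes "submod B" "linear_on B h" "pd_less n {x \<in> B. h x = (\<lambda>_. 0)}" "pd_less n (h ` B)"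
  shows "pd_less n B"
  using assms
proof (induction n arbitrary: B h)
  case 0
  then show ?case by auto
next
  case (Suc n)
  let ?A = "{x \<in> B. h x = (\<lambda>_. 0)}"
  obtain k a where a: "lin_comb k a ` free k = ?A" "pd_less n (syz k a)"
    using Suc.prems(3) by (rule pd_less_SucE)
  obtain m c where c: "lin_comb m c ` free m = h ` B" "pd_less n (syz m c)"
    using Suc.prems(4) by (rule pd_less_SucE)
  note aA = generator_mem[OF a(1)] and cB = generator_mem[OF c(1)]
  obtain b where b: "\<And>j. j < m \<Longrightarrow> b j \<in> B" "\<And>j. j < m \<Longrightarrow> h (b j) = c j"
  proof -
    have "\<forall>j<m. \<exists>z\<in>B. h z = c j"
      using cB by fastforce
    then show thesis using that by metis
  qed
  have hb: "h (lin_comb m b y) = lin_comb m c y" if "y \<in> free m" for y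
    using linear_on_image_lin_comb[OF Suc.prems(1,2), of m b y] b freeD[OF that]
      lin_comb_cong[of m y y "\<lambda>i. h (b i)" c] by simp
  have lcb: "lin_comb m b y \<in> B" if "y \<in> free m" for y
    using lin_comb_mem[OF Suc.prems(1), of m b y] b(1) freeD[OF that] by blast
  have lca: "lin_comb k a x \<in> B" "h (lin_comb k a x) = (\<lambda>_. 0)" if "x \<in> free k" for x
    using a(1) that by auto
  \<comment> \<open>\<open>lin_comb k a\<close> reads only the first k coordinates, so x may be cut
    off after them.\<close>
  have lca': "lin_comb k a x \<in> ?A" if "x \<in> free (k + m)" for x
  proof -
    have "join k x (\<lambda>_. 0) \<in> free k"
      using freeD[OF that] by (auto simp: free_def join_def)
    from imageI[OF this, of "lin_comb k a"] show ?thesis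
      by (simp add: a(1))
  qed
  let ?g = "join k a b"
  have gen: "lin_comb (k + m) ?g ` free (k + m) = B"
  proof (intro equalityI subsetI)
    fix z assume "z \<in> lin_comb (k + m) ?g ` free (k + m)"
    then show "z \<in> B"
      using lca' lcb shift_mem_free submod_add[OF Suc.prems(1)] by (auto simp: lin_comb_join)
  next
    fix z assume z: "z \<in> B"
    then obtain y where y: "y \<in> free m" "h z = lin_comb m c y"
      using c(1) by blast
    have "(\<lambda>i. z i - lin_comb m b y i) \<in> ?A"
      using z y lcb submod_diff[OF Suc.prems(1)]
      by (auto simp: linear_on_diff[OF Suc.prems(2,1)] hb)
    then obtain x where x: "x \<in> free k" "(\<lambda>i. z i - lin_comb m b y i) = lin_comb k a x"
      using a(1) by blast
    have "lin_comb (k + m) ?g (join k x y) = (\<lambda>i. lin_comb k a x i + lin_comb m b y i)"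
      by (simp add: lin_comb_join)
    also have "\<dots> = z"
      unfolding x(2)[symmetric] by simp
    finally show "z \<in> lin_comb (k + m) ?g ` free (k + m)"
      using join_mem_free[OF x(1) y(1)] by (metis image_eqI)
  qed
  note ker = syz_join_shift_eq_zero[of k m a b]
  have im: "shift k ` syz (k + m) ?g = syz m c"
  proof (intro equalityI subsetI)
    fix y assume "y \<in> shift k ` syz (k + m) ?g"
    then obtain x where xy: "x \<in> syz (k + m) ?g" "y = shift k x"
      by blast
    then have x: "x \<in> free (k + m)" "y = shift k x"
      and eq: "(\<lambda>j. lin_comb k a x j + lin_comb m b y j) = (\<lambda>_. 0)"
      by (simp_all add: syz_def lin_comb_join)
    have x3: "lin_comb m b y j = 0 - lin_comb k a x j" for j
      using fun_cong[OF eq, of j] by (simp add: eq_neg_iff_add_eq_0 add.commute)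
    have y: "y \<in> free m"
      using x shift_mem_free by simp
    have "h (lin_comb m b y) = h (\<lambda>j. 0 - lin_comb k a x j)"
      by (intro arg_cong[where f = h] ext) (rule x3)
    also have "\<dots> = (\<lambda>_. 0)"
      using lca'[OF x(1)] submod_zero[OF Suc.prems(1)] linear_on_zero[OF Suc.prems(2,1)]
      by (subst linear_on_diff[OF Suc.prems(2,1)]) auto
    finally show "y \<in> syz m c"
      using y hb by (simp add: syz_def)
  next
    \<comment> \<open>Surjectivity: a syzygy y of the c's combines the lifts to an element of the
      kernel of h. The negative of this element is a combination of the a's, and its coefficients
      complete y to a syzygy.\<close>
    fix y assume y: "y \<in> syz m c"
    then have "(\<lambda>j. 0 - lin_comb m b y j) \<in> ?A"
      using submod_zero[OF Suc.prems(1)] lcb submod_uminus[OF Suc.prems(1)]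
        linear_on_diff[OF Suc.prems(2,1), of "\<lambda>_. 0"] linear_on_zero[OF Suc.prems(2,1)] hb
      by (auto simp: syz_def)
    then obtain x where x: "x \<in> free k" "lin_comb k a x = (\<lambda>j. 0 - lin_comb m b y j)"
      using a(1) by (metis (no_types, lifting) imageE)
    have "join k x y \<in> syz (k + m) ?g"
      using y join_mem_free[of x k y m] x by (simp add: syz_def lin_comb_join)
    from imageI[OF this, of "shift k"] show "y \<in> shift k ` syz (k + m) ?g"
      by (simp only: shift_join)
  qed
  have "pd_less n (syz (k + m) ?g)"
    using Suc.IH[OF submod_syz linear_on_shift, of "k + m" ?g k] ker im a(2) c(2) by simp
  with gen show ?case
    by (rule pd_less_SucI)
qed

text \<open>In a relation between the combined generators, the a-part gives an element of M that is
  also the negative of an element of N. So the first syzygies \<open>?L\<close> of the sum are an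
  extension of \<open>M \<inter> N\<close> by the external sum of \<open>syz k a\<close> and
  \<open>syz m b\<close>. As \<open>?L\<close> sits one step further on, the intersection needs a
  resolution shorter by one.\<close>

lemma pd_less_sum:
  assumes "submod M" "submod N" "pd_less (Suc n) M" "pd_less (Suc n) N" "pd_less n (M \<inter> N)"
  shows "pd_less (Suc n) {\<lambda>i. x i + y i | x y. x \<in> M \<and> y \<in> N}"
proof -
  obtain k a where a: "lin_comb k a ` free k = M" "pd_less n (syz k a)"
    using assms(3) by (rule pd_less_SucE)
  obtain m b where b: "lin_comb m b ` free m = N" "pd_less n (syz m b)"
    using assms(4) by (rule pd_less_SucE)
  let ?g = "join k a b"
  let ?L = "syz (k + m) ?g"
  \<comment> \<open>The external sum of \<open>syz k a\<close> and \<open>syz m b\<close>, realised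
    as the kernel of the map from \<open>?L\<close> onto the intersection; it is itself resolved as
    an extension.\<close>
  let ?K = "{x \<in> ?L. lin_comb k a x = (\<lambda>_. 0)}"
  have aM: "lin_comb k a x \<in> M" if "x \<in> free (k + m)" for x
    by (rule lin_comb_mem[OF assms(1) generator_mem[OF a(1)]]) (use that freeD in auto)
  have bN: "lin_comb m b y \<in> N" if "y \<in> free m" for y
    using b that by auto
  have "{x \<in> ?K. shift k x = (\<lambda>_. 0)} = {x \<in> ?L. shift k x = (\<lambda>_. 0)}"
    by (auto simp: syz_def lin_comb_join)
  then have ker: "{x \<in> ?K. shift k x = (\<lambda>_. 0)} = syz k a"
    by (simp only: syz_join_shift_eq_zero)
  have im: "shift k ` ?K = syz m b"
  proof (intro equalityI subsetI)
    fix y assume "y \<in> shift k ` ?K"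
    then show "y \<in> syz m b"
      by (auto simp: syz_def lin_comb_join intro: shift_mem_free)
  next
    fix y assume y: "y \<in> syz m b"
    have "join k (\<lambda>_. 0) y \<in> ?K"
      using y join_mem_free[OF submod_zero[OF submod_free], of y m k] by (simp add: syz_def lin_comb_join)
    from imageI[OF this, of "shift k"] show "y \<in> shift k ` ?K"
      by (simp only: shift_join)
  qed
  have "submod ?K"
    using submod_syz[of "k + m" ?g] by (auto simp: submod_def lin_comb_add lin_comb_smult)
  then have K: "pd_less n ?K"
    using pd_less_extension[OF _ linear_on_shift, of ?K n k] ker im a(2) b(2) by simp
  have "lin_comb k a ` ?L = M \<inter> N"
  proof (intro equalityI subsetI)
    fix z assume "z \<in> lin_comb k a ` ?L"
    then obtain x where "x \<in> ?L" "z = lin_comb k a x"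
      by blast
    then have x: "x \<in> free (k + m)" "z = lin_comb k a x"
      and eq: "(\<lambda>j. lin_comb k a x j + lin_comb m b (shift k x) j) = (\<lambda>_. 0)"
      by (simp_all add: syz_def lin_comb_join)
    have "z j = - lin_comb m b (shift k x) j" for j
      using fun_cong[OF eq, of j] x(2) by (simp add: eq_neg_iff_add_eq_0)
    then have "z = (\<lambda>j. - lin_comb m b (shift k x) j)"
      by blast
    then show "z \<in> M \<inter> N"
      using aM[OF x(1)] x(2) submod_uminus[OF assms(2) bN[OF shift_mem_free[OF x(1)]]] by simp
  next
    fix z assume z: "z \<in> M \<inter> N"
    then have "(\<lambda>j. - z j) \<in> N"
      using submod_uminus[OF assms(2)] by auto
    with z obtain x y where x: "x \<in> free k" "z = lin_comb k a x"
      and y: "y \<in> free m" "(\<lambda>j. - z j) = lin_comb m b y"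
      using a(1) b(1) by blast
    have "join k x y \<in> ?L"
      using join_mem_free[OF x(1) y(1)] by (simp add: syz_def lin_comb_join flip: x(2) y(2))
    from imageI[OF this, of "lin_comb k a"] show "z \<in> lin_comb k a ` ?L"
      by (simp only: lin_comb_join_left x(2))
  qed
  then have L: "pd_less n ?L"
    using pd_less_extension[OF submod_syz linear_on_lin_comb, of n "k + m" ?g k a] K assms(5) by simp
  have "lin_comb (k + m) ?g ` free (k + m) = {\<lambda>i. x i + y i | x y. x \<in> M \<and> y \<in> N}"
  proof (intro equalityI subsetI)
    fix z assume "z \<in> lin_comb (k + m) ?g ` free (k + m)"
    then obtain x where "x \<in> free (k + m)"
      "z = (\<lambda>j. lin_comb k a x j + lin_comb m b (shift k x) j)"
      by (auto simp: lin_comb_join)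
    with aM bN[OF shift_mem_free] show "z \<in> {\<lambda>i. x i + y i | x y. x \<in> M \<and> y \<in> N}"
      by blast
  next
    fix z assume "z \<in> {\<lambda>i. x i + y i | x y. x \<in> M \<and> y \<in> N}"
    then obtain x y where "x \<in> free k" "y \<in> free m" "z = (\<lambda>i. lin_comb k a x i + lin_comb m b y i)"
      using a(1) b(1) by blast
    then show "z \<in> lin_comb (k + m) ?g ` free (k + m)"
      by (intro image_eqI[where x = "join k x y"]) (auto simp: lin_comb_join join_mem_free)
  qed
  then show ?thesis using L by (rule pd_less_SucI)
qed

end

section \<open>Identification of variables in polynomials\<close>

lemma poly_mapping_eq_sum_single: "p = (\<Sum>m\<in>Poly_Mapping.keys p. Poly_Mapping.single m (Poly_Mapping.lookup p m))"
  by (rule poly_mapping_eqI) (simp add: lookup_sum lookup_single when_def in_keys_iff)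

lemma poly_mapping_induct [case_names zero single add]:
  fixes p :: "'a \<Rightarrow>\<^sub>0 'b::comm_monoid_add"
  assumes "P 0" and "\<And>m c. P (Poly_Mapping.single m c)" and "\<And>p q. P p \<Longrightarrow> P q \<Longrightarrow> P (p + q)"
  shows "P p"
proof -
  have "P (\<Sum>m\<in>A. Poly_Mapping.single m (Poly_Mapping.lookup p m))" for A
    by (induction A rule: infinite_finite_induct) (auto intro: assms)
  then show ?thesis
    by (subst poly_mapping_eq_sum_single)
qed

definition eval_monom :: "(nat \<Rightarrow> 'a::comm_semiring_1) \<Rightarrow> (nat \<Rightarrow>\<^sub>0 nat) \<Rightarrow> 'a" where
  "eval_monom f m = (\<Prod>i\<in>Poly_Mapping.keys m. f i ^ Poly_Mapping.lookup m i)"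

definition subst :: "(nat \<Rightarrow> 'k::field mpoly) \<Rightarrow> 'k mpoly \<Rightarrow> 'k mpoly" where
  "subst f p = (\<Sum>m\<in>Poly_Mapping.keys p. Const (Poly_Mapping.lookup p m) * eval_monom f m)"

lemma eval_monom_superset:
  assumes "finite S" "Poly_Mapping.keys m \<subseteq> S"
  shows "eval_monom f m = (\<Prod>i\<in>S. f i ^ Poly_Mapping.lookup m i)"
  unfolding eval_monom_def using assms by (intro prod.mono_neutral_left) (auto simp: in_keys_iff)

lemma eval_monom_zero [simp]: "eval_monom f 0 = 1"
  by (simp add: eval_monom_def)

lemma eval_monom_single [simp]: "eval_monom f (Poly_Mapping.single i n) = f i ^ n"
  by (simp add: eval_monom_def)

lemma eval_monom_add: "eval_monom f (m + n) = eval_monom f m * eval_monom f n"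
proof -
  let ?S = "Poly_Mapping.keys m \<union> Poly_Mapping.keys n"
  have "eval_monom f (m + n) = (\<Prod>i\<in>?S. f i ^ Poly_Mapping.lookup (m + n) i)"
    using keys_add[of m n] by (intro eval_monom_superset) auto
  also have "\<dots> = (\<Prod>i\<in>?S. f i ^ Poly_Mapping.lookup m i) * (\<Prod>i\<in>?S. f i ^ Poly_Mapping.lookup n i)"
    by (simp add: lookup_add power_add prod.distrib)
  also have "\<dots> = eval_monom f m * eval_monom f n"
    by (simp add: eval_monom_superset[symmetric])
  finally show ?thesis .
qed

lemma Const_zero [simp]: "Const 0 = 0"
  and Const_one [simp]: "Const 1 = 1"
  and Const_add: "Const (a + b) = Const a + Const b"
  and Const_mult: "Const (a * b) = Const a * Const b"
  and Const_uminus: "Const (- a) = - Const a"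
  and Const_eq_zero_iff [simp]: "Const a = 0 \<longleftrightarrow> a = 0"
  by (simp_all add: Const_def single_add mult_single single_uminus)
    (metis inj_single injD single_zero)

lemma subst_superset:
  assumes "finite S" "Poly_Mapping.keys p \<subseteq> S"
  shows "subst f p = (\<Sum>m\<in>S. Const (Poly_Mapping.lookup p m) * eval_monom f m)"
  unfolding subst_def using assms by (intro sum.mono_neutral_left) (auto simp: in_keys_iff)

lemma subst_single: "subst f (Poly_Mapping.single m c) = Const c * eval_monom f m"
  by (simp add: subst_def)

lemma subst_add [simp]: "subst f (p + q) = subst f p + subst f q"
proof -
  let ?S = "Poly_Mapping.keys p \<union> Poly_Mapping.keys q"
  have "subst f (p + q) = (\<Sum>m\<in>?S. Const (Poly_Mapping.lookup (p + q) m) * eval_monom f m)"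
    using keys_add[of p q] by (intro subst_superset) auto
  also have "\<dots> = (\<Sum>m\<in>?S. Const (Poly_Mapping.lookup p m) * eval_monom f m) +
      (\<Sum>m\<in>?S. Const (Poly_Mapping.lookup q m) * eval_monom f m)"
    by (simp add: lookup_add Const_add distrib_right sum.distrib)
  also have "\<dots> = subst f p + subst f q"
    by (simp add: subst_superset[symmetric])
  finally show ?thesis .
qed

lemma subst_zero [simp]: "subst f 0 = 0"
  by (simp add: subst_def)

lemma subst_mult [simp]: "subst f (p * q) = subst f p * subst f q"
proof (induction p rule: poly_mapping_induct)
  case (single m c)
  show ?case
  proof (induction q rule: poly_mapping_induct)
    case (single n d)
    then show ?case
      by (simp add: mult_single subst_single eval_monom_add Const_mult)
  qed (simp_all add: distrib_left)
qed (simp_all add: distrib_right)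

lemma subst_one [simp]: "subst f 1 = 1"
  using subst_single[of f 0 1] by simp

lemma subst_Const [simp]: "subst f (Const c) = Const c"
  using subst_single[of f 0 c] by (simp add: Const_def[symmetric])

lemma subst_Var [simp]: "subst f (Var i) = f i"
  by (simp add: Var_def subst_single)

lemma subst_uminus [simp]: "subst f (- p) = - subst f p"
  using subst_add[of f p "- p"] by (simp add: eq_neg_iff_add_eq_0 add.commute)

lemma subst_diff [simp]: "subst f (p - q) = subst f p - subst f q"
  using subst_add[of f p "- q"] by simp

lemma subst_prod: "subst f (prod g I) = (\<Prod>i\<in>I. subst f (g i))"
  by (induction I rule: infinite_finite_induct) auto

lemma Var_power: "Var i ^ n = Poly_Mapping.single (Poly_Mapping.single i n) 1"
proof (induction n)
  case (Suc n)
  have "Poly_Mapping.single i 1 + Poly_Mapping.single i n = Poly_Mapping.single i (Suc n)"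
    by (simp flip: single_add)
  with Suc show ?case by (simp add: Var_def mult_single)
qed simp

lemma eval_monom_Var: "eval_monom Var m = Poly_Mapping.single m 1"
  by (induction m rule: poly_mapping_induct)
    (simp_all add: Var_power eval_monom_add mult_single)

lemma single_eq_Const_mult: "Poly_Mapping.single m c = Const c * eval_monom Var m"
  by (simp add: eval_monom_Var Const_def mult_single)

lemma subst_Var_id [simp]: "subst Var p = p"
  unfolding subst_def single_eq_Const_mult[symmetric]
  by (rule poly_mapping_eq_sum_single[symmetric])

lemma mpoly_induct [case_names Const Var add mult]:
  assumes "\<And>c. P (Const c)" "\<And>i. P (Var i)" "\<And>p q. P p \<Longrightarrow> P q \<Longrightarrow> P (p + q)"
    and mult: "\<And>p q. P p \<Longrightarrow> P q \<Longrightarrow> P (p * q)"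
  shows "P p"
proof (induction p rule: poly_mapping_induct)
  case (single m c)
  have one: "P 1"
    using assms(1)[of 1] by simp
  then have "P (Var i ^ n)" for i n
    by (induction n) (auto intro: assms)
  with one have "P (\<Prod>i\<in>A. Var i ^ Poly_Mapping.lookup m i)" for A
    by (induction A rule: infinite_finite_induct) (auto intro: mult)
  then show ?case
    by (simp add: single_eq_Const_mult eval_monom_def assms)
qed (use assms(1)[of 0] assms in auto)

lemma subst_subst: "subst f (subst g p) = subst (\<lambda>i. subst f (g i)) p"
  by (induction p rule: mpoly_induct) simp_all

section \<open>The subring of polynomials in l variables, and identification of variables\<close>

definition polys :: "nat \<Rightarrow> 'k::field mpoly set" where
  "polys l = carrier (poly_ring l)"

lemma mem_polys: "p \<in> polys l \<longleftrightarrow> (\<forall>m\<in>Poly_Mapping.keys p. Poly_Mapping.keys m \<subseteq> {1..l})"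
  by (simp add: polys_def poly_ring_def)

lemma polys_keysD: "p \<in> polys l \<Longrightarrow> m \<in> Poly_Mapping.keys p \<Longrightarrow> i \<in> Poly_Mapping.keys m \<Longrightarrow> i \<in> {1..l}"
  unfolding mem_polys by blast

lemma polys_add: "p \<in> polys l \<Longrightarrow> q \<in> polys l \<Longrightarrow> p + q \<in> polys l"
  using keys_add[of p q] unfolding mem_polys by blast

lemma polys_mult:
  assumes "p \<in> polys l" "q \<in> polys l" shows "p * q \<in> polys l"
  unfolding mem_polys
proof
  fix m assume "m \<in> Poly_Mapping.keys (p * q)"
  then obtain a b where m: "m = a + b" "a \<in> Poly_Mapping.keys p" "b \<in> Poly_Mapping.keys q"
    using keys_mult[of p q] by blast
  with assms have "Poly_Mapping.keys a \<union> Poly_Mapping.keys b \<subseteq> {1..l}"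
    by (simp add: mem_polys)
  with m(1) keys_add[of a b] show "Poly_Mapping.keys m \<subseteq> {1..l}"
    by blast
qed

lemma polys_Const: "Const c \<in> polys l"
  by (auto simp: mem_polys Const_def split: if_splits)

lemma polys_Var: "i \<in> {1..l} \<Longrightarrow> Var i \<in> polys l"
  by (auto simp: mem_polys Var_def)

lemma polys_zero: "0 \<in> polys l" and polys_one: "1 \<in> polys l"
  using polys_Const[of 0 l] polys_Const[of 1 l] by auto

lemma polys_uminus: "p \<in> polys l \<Longrightarrow> - p \<in> polys l"
  using polys_mult[OF polys_Const[of "- 1"], of p l] by (simp add: Const_uminus)

lemma polys_diff: "p \<in> polys l \<Longrightarrow> q \<in> polys l \<Longrightarrow> p - q \<in> polys l"
  using polys_add[of p l "- q"] polys_uminus[of q l] by simp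

lemma polys_prod: "(\<And>i. i \<in> I \<Longrightarrow> f i \<in> polys l) \<Longrightarrow> prod f I \<in> polys l"
  by (induction I rule: infinite_finite_induct) (auto simp: polys_one polys_mult)

lemma polys_sum: "(\<And>i. i \<in> I \<Longrightarrow> f i \<in> polys l) \<Longrightarrow> sum f I \<in> polys l"
  by (induction I rule: infinite_finite_induct) (auto simp: polys_zero polys_add)

lemma polys_power: "p \<in> polys l \<Longrightarrow> p ^ n \<in> polys l"
  by (induction n) (auto simp: polys_one polys_mult)

lemma polys_subst:
  assumes "p \<in> polys l" "\<And>i. i \<in> {1..l} \<Longrightarrow> f i \<in> polys l"
  shows "subst f p \<in> polys l"
  unfolding subst_def eval_monom_def
  using assms polys_keysD by (blast intro: polys_sum polys_mult polys_Const polys_prod polys_power)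

text \<open>Membership in the subring becomes an equation that is compatible with products: being
  fixed by the homomorphism that kills the other variables.\<close>

lemma polys_iff_retract:
  "p \<in> polys l \<longleftrightarrow> subst (\<lambda>i. if i \<in> {1..l} then Var i else 0) p = p" (is "_ \<longleftrightarrow> subst ?f p = p")
proof
  assume p: "p \<in> polys l"
  have "eval_monom ?f m = eval_monom Var m" if "m \<in> Poly_Mapping.keys p" for m
    unfolding eval_monom_def using polys_keysD[OF p that] by (intro prod.cong) auto
  then have "subst ?f p = subst Var p"
    by (simp add: subst_def)
  then show "subst ?f p = p" by simp
next
  have "subst ?f p \<in> polys l"
    by (induction p rule: mpoly_induct)
      (auto simp: polys_Const polys_zero polys_add polys_mult intro!: polys_Var)
  then show "subst ?f p = p \<Longrightarrow> p \<in> polys l" by simp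
qed

text \<open>The retraction fixes d and \<open>d * q\<close>, hence also q, by cancellation in a
  domain. Through this, all later quotients by products of linear forms stay in S.\<close>

lemma polys_quotient:
  assumes "d * q \<in> polys l" "d \<in> polys l" "d \<noteq> 0"
  shows "q \<in> polys l"
proof -
  have "d * subst (\<lambda>i. if i \<in> {1..l} then Var i else 0) q = d * q"
    using assms(1,2) by (simp add: polys_iff_retract)
  then show ?thesis using assms(3) by (simp add: polys_iff_retract)
qed

text \<open>Restriction to the subspace where x_i = x_v for all i in U, with x_v as the remaining
  coordinate. The result stays in the same polynomial ring, so restrictions can be composed and
  compared.\<close>

definition identify :: "nat set \<Rightarrow> nat \<Rightarrow> 'k::field mpoly \<Rightarrow> 'k mpoly" where
  "identify U v = subst (\<lambda>i. if i \<in> U then Var v else Var i)"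

lemma identify_simps [simp]:
  "identify U v 0 = 0" "identify U v 1 = 1" "identify U v (Const c) = Const c"
  "identify U v (Var i) = (if i \<in> U then Var v else Var i)"
  "identify U v (p + q) = identify U v p + identify U v q"
  "identify U v (p - q) = identify U v p - identify U v q"
  "identify U v (- p) = - identify U v p"
  "identify U v (p * q) = identify U v p * identify U v q"
  "identify U v (prod f I) = (\<Prod>i\<in>I. identify U v (f i))"
  by (simp_all add: identify_def subst_prod)

lemma polys_identify: "p \<in> polys l \<Longrightarrow> v \<in> {1..l} \<Longrightarrow> identify U v p \<in> polys l"
  unfolding identify_def by (rule polys_subst) (auto intro: polys_Var[unfolded atLeastAtMost_iff])

lemma identify_identify: "identify U v (identify W v p) = identify (U \<union> W) v p"
  unfolding identify_def subst_subst by (rule arg_cong[where f = "\<lambda>f. subst f p"]) auto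

text \<open>Passes from x_v to x_u as the remaining coordinate, for use where a condition written in
  x_v meets polynomials from which x_v has been eliminated.\<close>

lemma identify_retarget:
  "identify {v} u (identify U v p) = identify (insert v (U - {u})) u p"
  unfolding identify_def subst_subst by (rule arg_cong[where f = "\<lambda>f. subst f p"]) auto

lemma Var_eq_iff [simp]: "(Var i :: 'k::field mpoly) = Var j \<longleftrightarrow> i = j"
proof
  assume "(Var i :: 'k mpoly) = Var j"
  then have "subst (\<lambda>k. if k = i then 1 else 0) (Var i :: 'k mpoly) = subst (\<lambda>k. if k = i then 1 else 0) (Var j)"
    by simp
  then show "i = j" by (simp split: if_splits)
qed simp

section \<open>Divisibility by differences of variables\<close>

abbreviation lin :: "nat \<Rightarrow> nat \<Rightarrow> 'k::field mpoly" where
  "lin a b \<equiv> Var a - Var b"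

text \<open>The factor theorem: the polynomials that agree with their substitution modulo x_a - x_b
  contain constants and variables and are closed under sums and products.\<close>

lemma lin_dvd_diff_identify: "lin a b dvd p - identify {a} b p"
proof (induction p rule: mpoly_induct)
  case (add p q)
  have "p + q - identify {a} b (p + q) = (p - identify {a} b p) + (q - identify {a} b q)"
    by simp
  with add show ?case by (metis dvd_add)
next
  case (mult p q)
  have "p * q - identify {a} b (p * q) = (p - identify {a} b p) * q + identify {a} b p * (q - identify {a} b q)"
    by (simp add: algebra_simps)
  with mult show ?case by (metis dvd_add dvd_mult dvd_mult2)
qed auto

text \<open>So x_a - x_b generates the kernel of a homomorphism into a domain, which yields
  primeness right below. For a = b both sides say p = 0.\<close>

lemma lin_dvd_iff: "lin a b dvd p \<longleftrightarrow> identify {a} b p = 0"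
proof
  assume "lin a b dvd p"
  then show "identify {a} b p = 0" by (auto simp: dvd_def)
next
  assume "identify {a} b p = 0"
  then show "lin a b dvd p" using lin_dvd_diff_identify[of a b p] by simp
qed

lemma lin_dvd_mult_iff: "lin a b dvd p * q \<longleftrightarrow> lin a b dvd p \<or> lin a b dvd q"
  by (simp add: lin_dvd_iff)

lemma lin_dvd_prod_iff: "finite I \<Longrightarrow> lin a b dvd prod f I \<longleftrightarrow> (\<exists>i\<in>I. lin a b dvd f i)"
  by (simp add: lin_dvd_iff)

lemma lin_dvd_lin_iff: "lin a b dvd lin c d \<longleftrightarrow> c = d \<or> {a, b} = {c, d}"
  by (auto simp: lin_dvd_iff doubleton_eq_iff)

lemma lin_dvd_commute: "lin a b dvd p \<longleftrightarrow> lin b a dvd p"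
  by (metis minus_diff_eq minus_dvd_iff)

text \<open>A prime that divides \<open>p\<close>, but none of the other factors, divides the
  cofactor that is left after these have been split off.\<close>

lemma prod_lin_dvd:
  assumes "finite T" "\<And>t. t \<in> T \<Longrightarrow> lin (f t) (g t) dvd p"
    and "\<And>t t'. t \<in> T \<Longrightarrow> t' \<in> T \<Longrightarrow> t \<noteq> t' \<Longrightarrow> \<not> lin (f t) (g t) dvd (lin (f t') (g t') :: 'k mpoly)"
  shows "(\<Prod>t\<in>T. lin (f t) (g t)) dvd (p :: 'k::field mpoly)"
  using assms
proof (induction T)
  case (insert t T)
  then obtain q where q: "p = (\<Prod>t\<in>T. lin (f t) (g t)) * q"
    by (auto simp: dvd_def)
  have "lin (f t) (g t) dvd p"
    using insert.prems by simp
  moreover have "\<not> lin (f t) (g t) dvd (\<Prod>t\<in>T. lin (f t) (g t) :: 'k mpoly)"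
    using insert by (subst lin_dvd_prod_iff) auto
  ultimately have "lin (f t) (g t) dvd q"
    by (simp add: q lin_dvd_mult_iff)
  then show ?case
    using insert.hyps by (auto simp: q dvd_def mult_ac)
qed simp

section \<open>Cover ideals\<close>

locale graph_polys =
  fixes l :: nat and E :: "nat set set" and R :: "'k::field mpoly set"
  assumes R_eq: "R = polys l"
begin

sublocale scalars R
  by unfold_locales (simp_all add: R_eq polys_zero polys_one polys_add polys_mult polys_uminus)

lemma Var_R: "i \<in> {1..l} \<Longrightarrow> Var i \<in> R"
  by (simp only: R_eq polys_Var)

lemma lin_R: "a \<in> {1..l} \<Longrightarrow> b \<in> {1..l} \<Longrightarrow> lin a b \<in> R"
  by (intro diff_R Var_R)

lemma identify_R: "p \<in> R \<Longrightarrow> v \<in> {1..l} \<Longrightarrow> identify U v p \<in> R"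
  by (simp only: R_eq polys_identify)

lemma quotient_R: "d * q \<in> R \<Longrightarrow> d \<in> R \<Longrightarrow> d \<noteq> 0 \<Longrightarrow> q \<in> R"
  unfolding R_eq by (rule polys_quotient)

lemma linear_on_scale: "linear_on M (\<lambda>x i. c * x i)"
  by (simp add: linear_on_def algebra_simps)

lemma pd_less_scale:
  assumes "submod M" "c \<noteq> 0" "pd_less n M"
  shows "pd_less n ((\<lambda>x i. c * x i) ` M)"
proof (rule pd_less_iso[OF assms(1) linear_on_scale _ assms(3)])
  show "inj_on (\<lambda>x i. c * x i) M"
    using assms(2) by (auto simp: inj_on_def fun_eq_iff)
qed

text \<open>Turns ideals into modules of the type that \<open>pd_less\<close> handles, as vectors
  supported in coordinate 0.\<close>

definition embed :: "'k mpoly \<Rightarrow> nat \<Rightarrow> 'k mpoly" where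
  "embed p = (\<lambda>i. if i = 0 then p else 0)"

lemma embed_eq_iff [simp]: "embed p = embed q \<longleftrightarrow> p = q"
  by (auto simp: embed_def fun_eq_iff)

lemma embed_zero: "embed 0 = (\<lambda>_. 0)"
  by (auto simp: embed_def)

lemma embed_add: "embed (p + q) = (\<lambda>i. embed p i + embed q i)"
  by (auto simp: embed_def)

lemma embed_mult: "embed (c * p) = (\<lambda>i. c * embed p i)"
  by (auto simp: embed_def)

lemma image_embed_mult: "embed ` ((*) c ` I) = (\<lambda>x i. c * x i) ` (embed ` I)"
  by (simp add: image_image embed_mult)

lemma pd_less_embed_R: "pd_less (Suc 0) (embed ` R)"
proof (rule pd_less_SucI)
  have *: "lin_comb 1 (\<lambda>_. embed 1) x = embed (x 0)" for x
    by (rule ext) (simp add: lin_comb_def embed_def)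
  show "lin_comb 1 (\<lambda>_. embed 1) ` free 1 = embed ` R"
  proof (intro equalityI subsetI)
    fix z assume "z \<in> lin_comb 1 (\<lambda>_. embed 1) ` free 1"
    then show "z \<in> embed ` R"
      unfolding * using freeD by blast
  next
    fix z assume "z \<in> embed ` R"
    then obtain p where p: "p \<in> R" "z = embed p" by blast
    have "embed p \<in> free 1"
      using p(1) by (simp add: free_def embed_def)
    moreover have "lin_comb 1 (\<lambda>_. embed 1) (embed p) = z"
      unfolding * p(2) by (simp add: embed_def)
    ultimately show "z \<in> lin_comb 1 (\<lambda>_. embed 1) ` free 1" by blast
  qed
  have "x = (\<lambda>_. 0)" if "x \<in> free 1" "embed (x 0) = (\<lambda>_. 0)" for x
  proof
    fix i
    have "x 0 = 0"
      using that(2) by (simp flip: embed_zero)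
    then show "x i = 0"
      using that(1) by (cases "i = 0") (simp_all add: free_def)
  qed
  then show "pd_less 0 (syz 1 (\<lambda>_. embed 1))"
    using submod_zero[OF submod_syz[of 1 "\<lambda>_. embed 1"]] unfolding pd_less.simps syz_def * by blast
qed

text \<open>The intersection of the primes generated by x_a - x_v and x_b - x_v over the
  non-adjacent pairs, hence a cover ideal of the complement graph. The form by vanishing is the one
  in which log forms produce it, and it lets quotients be tested by substitution.\<close>

definition cover_ideal :: "nat \<Rightarrow> nat set \<Rightarrow> 'k mpoly set" where
  "cover_ideal v U =
     {g \<in> R. \<forall>a\<in>U. \<forall>b\<in>U. a \<noteq> b \<and> {a, b} \<notin> E \<longrightarrow> identify {a, b} v g = 0}"

lemma cover_ideal_mult: "g \<in> cover_ideal v U \<Longrightarrow> c \<in> R \<Longrightarrow> c * g \<in> cover_ideal v U"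
  by (simp add: cover_ideal_def)

lemma cover_ideal_add: "g \<in> cover_ideal v U \<Longrightarrow> h \<in> cover_ideal v U \<Longrightarrow> g + h \<in> cover_ideal v U"
  unfolding cover_ideal_def by (auto simp del: identify_simps(8))

lemma cover_ideal_mono: "U \<subseteq> U' \<Longrightarrow> cover_ideal v U' \<subseteq> cover_ideal v U"
  by (auto simp: cover_ideal_def)

lemma submod_cover_ideal: "submod (embed ` cover_ideal v U)"
  unfolding submod_def
proof (safe)
  show "(\<lambda>_. 0) \<in> embed ` cover_ideal v U"
    by (rule image_eqI[of _ _ 0]) (auto simp: embed_zero cover_ideal_def)
next
  fix p q assume "p \<in> cover_ideal v U" "q \<in> cover_ideal v U"
  then show "(\<lambda>i. embed p i + embed q i) \<in> embed ` cover_ideal v U"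
    by (intro image_eqI[of _ _ "p + q"]) (auto simp: embed_add cover_ideal_def)
next
  fix c p assume "c \<in> R" "p \<in> cover_ideal v U"
  then show "(\<lambda>i. c * embed p i) \<in> embed ` cover_ideal v U"
    by (intro image_eqI[of _ _ "c * p"]) (auto simp: embed_mult cover_ideal_mult)
qed

lemma pd_less_cover_ideal_scale:
  assumes "c \<noteq> 0" "pd_less n (embed ` cover_ideal v U)"
  shows "pd_less n (embed ` ((*) c ` cover_ideal v U))"
  unfolding image_embed_mult by (rule pd_less_scale[OF submod_cover_ideal assms])

lemma submod_cover_ideal_scale: "submod (embed ` ((*) c ` cover_ideal v U))"
proof -
  have "\<exists>z\<in>embed ` cover_ideal v U. (\<lambda>i. c * x i + c * y i) = (\<lambda>i. c * z i)"
    if "x \<in> embed ` cover_ideal v U" "y \<in> embed ` cover_ideal v U" for x y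
    by (rule bexI[OF _ submod_add[OF submod_cover_ideal that]]) (simp add: distrib_left)
  moreover have "\<exists>z\<in>embed ` cover_ideal v U. (\<lambda>i. d * (c * x i)) = (\<lambda>i. c * z i)"
    if "x \<in> embed ` cover_ideal v U" "d \<in> R" for x d
    by (rule bexI[OF _ submod_smult[OF submod_cover_ideal that(2,1)]]) (simp add: mult_ac)
  moreover have "\<exists>z\<in>embed ` cover_ideal v U. (\<lambda>_. 0) = (\<lambda>i. c * z i)"
    by (rule bexI[OF _ submod_zero[OF submod_cover_ideal]]) simp
  ultimately show ?thesis
    unfolding image_embed_mult submod_def by (auto simp: image_iff)
qed

section \<open>The recursion for cover ideals at a vertex u, with T its neighbours in the complement
  graph\<close>

context
  fixes v u :: nat and U T :: "nat set" and y m :: "'k mpoly"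
  assumes v: "v \<in> {1..l}" and U: "U \<subseteq> {1..l}" and vU: "v \<notin> U" and u: "u \<in> U"
  defines "T \<equiv> {w \<in> U. w \<noteq> u \<and> {u, w} \<notin> E}"
  defines "y \<equiv> lin u v" and "m \<equiv> \<Prod>w\<in>T. lin w v"
begin

lemma cover_aux_R: "y \<in> R" "m \<in> R" "finite T"
  using v u U finite_subset[OF U] by (auto simp: y_def m_def T_def intro!: lin_R prod_R)

lemma cover_aux_nonzero: "y \<noteq> 0" "m \<noteq> 0"
  using u vU cover_aux_R(3) by (auto simp: y_def m_def T_def)

lemma identify_y: "u \<notin> A \<Longrightarrow> identify A v y = y"
  using u vU by (auto simp: y_def)

lemma identify_m: "A \<inter> T = {} \<Longrightarrow> identify A v m = m"
  unfolding m_def by (auto intro!: prod.cong)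

lemma identify_m_eq_zero: "A \<inter> T \<noteq> {} \<Longrightarrow> identify A v m = 0"
  using cover_aux_R(3) unfolding m_def by auto

lemma y_mult_cover: "g \<in> cover_ideal v (U - {u}) \<Longrightarrow> y * g \<in> cover_ideal v U"
  using cover_aux_R by (auto simp: cover_ideal_def y_def)

text \<open>A non-adjacent pair that contains u has its other member in T. So every pair on which m
  does not vanish avoids u as well as T, and g takes care of it.\<close>

lemma m_mult_cover:
  assumes "g \<in> cover_ideal v (U - {u} - T)" shows "m * g \<in> cover_ideal v U"
  unfolding cover_ideal_def
proof (intro CollectI conjI ballI impI)
  show "m * g \<in> R" using assms cover_aux_R by (simp add: cover_ideal_def)
  fix a b assume ab: "a \<in> U" "b \<in> U" "a \<noteq> b \<and> {a, b} \<notin> E"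
  show "identify {a, b} v (m * g) = 0"
  proof (cases "{a, b} \<inter> T = {}")
    case True
    then have "a \<noteq> u" "b \<noteq> u" using ab by (auto simp: T_def insert_commute)
    with True ab assms show ?thesis by (simp add: cover_ideal_def)
  next
    case False
    then show ?thesis using identify_m_eq_zero by simp
  qed
qed

text \<open>Division by y with remainder \<open>?f0\<close>, the restriction of f to y = 0. For w in
  T, f vanishes on x_u = x_w = x_v, so \<open>?f0\<close> vanishes on x_w = x_v. All these primes
  divide the remainder, which is therefore a multiple of m.\<close>

lemma cover_split:
  assumes f: "f \<in> cover_ideal v U"
  obtains g h where "g \<in> cover_ideal v (U - {u})" "h \<in> cover_ideal v (U - {u} - T)" "f = y * g + m * h"
proof -
  let ?f0 = "identify {u} v f"
  have fR: "f \<in> R" using f by (simp add: cover_ideal_def)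
  have f0R: "?f0 \<in> R" using fR v by (rule identify_R)
  obtain g where g: "f - ?f0 = y * g"
    using lin_dvd_diff_identify[of u v f] unfolding y_def by (rule dvdE)
  have gR: "g \<in> R"
    using diff_R[OF fR f0R] cover_aux_R(1) cover_aux_nonzero(1) unfolding g by (rule quotient_R)
  have z: "identify {a, b} v f = 0" "identify {a, b} v ?f0 = 0"
    if "a \<in> U" "b \<in> U" "a \<noteq> b" "{a, b} \<notin> E" for a b
  proof -
    show 1: "identify {a, b} v f = 0"
      using f that by (simp add: cover_ideal_def)
    \<comment> \<open>Restriction to y = 0 commutes with the other identifications, so the remainder
      inherits every vanishing condition of f.\<close>
    have "identify {a, b} v ?f0 = identify {u} v (identify {a, b} v f)"
      by (simp add: identify_identify insert_commute)
    then show "identify {a, b} v ?f0 = 0" by (simp add: 1)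
  qed
  have gJ: "g \<in> cover_ideal v (U - {u})"
    unfolding cover_ideal_def
  proof (intro CollectI conjI ballI impI gR)
    fix a b assume ab: "a \<in> U - {u}" "b \<in> U - {u}" "a \<noteq> b \<and> {a, b} \<notin> E"
    have "identify {a, b} v (y * g) = 0"
      using z[of a b] ab by (simp flip: g)
    moreover have "identify {a, b} v y = y"
      using ab by (intro identify_y) auto
    ultimately show "identify {a, b} v g = 0"
      using cover_aux_nonzero by simp
  qed
  have "m dvd ?f0"
    unfolding m_def
  proof (rule prod_lin_dvd)
    fix w assume w: "w \<in> T"
    then have "identify {w} v ?f0 = identify {u, w} v f"
      by (simp add: identify_identify insert_commute)
    then show "lin w v dvd ?f0"
      using w u z(1)[of u w] by (auto simp: lin_dvd_iff T_def)
  next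
    fix w w' assume "w \<in> T" "w' \<in> T" "w \<noteq> w'"
    then show "\<not> lin w v dvd (lin w' v :: 'k mpoly)"
      using vU by (auto simp: lin_dvd_lin_iff T_def doubleton_eq_iff)
  qed (rule cover_aux_R)
  then obtain h where h: "?f0 = m * h" by (rule dvdE)
  have hR: "h \<in> R"
    using f0R cover_aux_R(2) cover_aux_nonzero(2) unfolding h by (rule quotient_R)
  \<comment> \<open>No factor of m involves x_a or x_b, as a and b are outside T, so m survives the
    identification unchanged and can be cancelled.\<close>
  have hJ: "h \<in> cover_ideal v (U - {u} - T)"
    unfolding cover_ideal_def
  proof (intro CollectI conjI ballI impI hR)
    fix a b assume ab: "a \<in> U - {u} - T" "b \<in> U - {u} - T" "a \<noteq> b \<and> {a, b} \<notin> E"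
    have "identify {a, b} v (m * h) = 0"
      using z[of a b] ab by (simp flip: h)
    moreover have "identify {a, b} v m = m"
      using ab by (intro identify_m) auto
    ultimately show "identify {a, b} v h = 0"
      using cover_aux_nonzero by simp
  qed
  have "f = y * g + m * h"
    using g h by (simp add: diff_eq_eq)
  with gJ hJ show thesis by (rule that)
qed

lemma cover_sum:
  "{\<lambda>i. x i + z i | x z. x \<in> embed ` ((*) y ` cover_ideal v (U - {u})) \<and>
     z \<in> embed ` ((*) m ` cover_ideal v (U - {u} - T))} = embed ` cover_ideal v U" (is "?L = _")
proof (intro equalityI subsetI)
  fix s assume "s \<in> ?L"
  then obtain g h where gh: "g \<in> cover_ideal v (U - {u})" "h \<in> cover_ideal v (U - {u} - T)"
    and "s = (\<lambda>i. embed (y * g) i + embed (m * h) i)"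
    by blast
  then have s: "s = embed (y * g + m * h)"
    by (simp only: embed_add)
  have "y * g + m * h \<in> cover_ideal v U"
    using y_mult_cover[OF gh(1)] m_mult_cover[OF gh(2)] by (rule cover_ideal_add)
  then show "s \<in> embed ` cover_ideal v U"
    unfolding s by (rule imageI)
next
  fix s assume "s \<in> embed ` cover_ideal v U"
  then obtain f where f: "f \<in> cover_ideal v U" "s = embed f" by blast
  from cover_split[OF f(1)] obtain g h where gh: "g \<in> cover_ideal v (U - {u})"
    "h \<in> cover_ideal v (U - {u} - T)" "f = y * g + m * h" .
  have "s = (\<lambda>i. embed (y * g) i + embed (m * h) i)"
    by (simp only: f(2) gh(3) embed_add)
  then show "s \<in> ?L"
    using gh(1,2) by blast
qed

text \<open>y is prime and divides no factor of m, so \<open>y * g = m * h\<close> forces y to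
  divide h. Hence the intersection is a scaled copy of a single smaller cover ideal.\<close>

lemma cover_inter:
  "embed ` ((*) y ` cover_ideal v (U - {u})) \<inter> embed ` ((*) m ` cover_ideal v (U - {u} - T)) =
   embed ` ((*) (y * m) ` cover_ideal v (U - {u} - T))" (is "?L = ?R")
proof (intro equalityI subsetI)
  fix s assume "s \<in> ?L"
  then have "s \<in> embed ` ((*) y ` cover_ideal v (U - {u}))"
    and "s \<in> embed ` ((*) m ` cover_ideal v (U - {u} - T))"
    by (rule IntD1, rule IntD2)
  then obtain g h where gh: "g \<in> cover_ideal v (U - {u})" "h \<in> cover_ideal v (U - {u} - T)"
    "s = embed (m * h)" and "s = embed (y * g)"
    by (elim imageE) simp
  then have eq: "y * g = m * h" by simp
  have "\<not> lin u v dvd (lin w v :: 'k mpoly)" if "w \<in> T" for w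
    using vU u that by (auto simp: lin_dvd_lin_iff T_def doubleton_eq_iff)
  then have "\<not> y dvd m"
    by (simp add: y_def m_def lin_dvd_prod_iff[OF cover_aux_R(3)])
  moreover have "y dvd m * h"
    unfolding eq[symmetric] by (rule dvd_triv_left)
  ultimately have "y dvd h"
    unfolding y_def by (simp add: lin_dvd_mult_iff)
  then obtain h' where h': "h = y * h'" by (rule dvdE)
  have "h' \<in> cover_ideal v (U - {u} - T)"
    unfolding cover_ideal_def
  proof (intro CollectI conjI ballI impI)
    show "h' \<in> R"
      using gh(2) h' quotient_R[of y h'] cover_aux_R cover_aux_nonzero by (simp add: cover_ideal_def)
    fix a b assume ab: "a \<in> U - {u} - T" "b \<in> U - {u} - T" "a \<noteq> b \<and> {a, b} \<notin> E"
    have "identify {a, b} v (y * h') = 0"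
      using gh(2) h' ab by (simp add: cover_ideal_def)
    moreover have "identify {a, b} v y = y"
      using ab by (intro identify_y) auto
    ultimately show "identify {a, b} v h' = 0"
      using cover_aux_nonzero by simp
  qed
  moreover have "s = embed (y * m * h')"
    by (simp only: gh(3) h' mult_ac)
  ultimately show "s \<in> ?R" by blast
next
  fix s assume "s \<in> ?R"
  then obtain h where h: "h \<in> cover_ideal v (U - {u} - T)" "s = embed (y * (m * h))"
    by (elim imageE) (simp add: mult.assoc)
  have "m * h \<in> cover_ideal v (U - {u})"
    using m_mult_cover[OF h(1)] cover_ideal_mono[of "U - {u}" U v] by auto
  moreover have "y * h \<in> cover_ideal v (U - {u} - T)"
    by (rule cover_ideal_mult[OF h(1) cover_aux_R(1)])
  moreover have "s = embed (m * (y * h))"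
    by (simp only: h(2) mult_ac)
  ultimately show "s \<in> ?L"
    using h(2) by blast
qed

text \<open>The ideal without u and T enters twice: as a summand, where a bound of
  \<open>Suc n\<close> would do, and as the intersection, where n is required.\<close>

lemma cover_step:
  assumes "pd_less (Suc n) (embed ` cover_ideal v (U - {u}))"
    and "pd_less n (embed ` cover_ideal v (U - {u} - T))"
  shows "pd_less (Suc n) (embed ` cover_ideal v U)"
proof -
  have "pd_less (Suc n) {\<lambda>i. x i + z i | x z. x \<in> embed ` ((*) y ` cover_ideal v (U - {u})) \<and>
     z \<in> embed ` ((*) m ` cover_ideal v (U - {u} - T))}"
  proof (rule pd_less_sum[OF submod_cover_ideal_scale submod_cover_ideal_scale])
    show "pd_less (Suc n) (embed ` ((*) y ` cover_ideal v (U - {u})))"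
      using cover_aux_nonzero(1) assms(1) by (rule pd_less_cover_ideal_scale)
    show "pd_less (Suc n) (embed ` ((*) m ` cover_ideal v (U - {u} - T)))"
      using cover_aux_nonzero(2) pd_less_Suc[OF assms(2)] by (rule pd_less_cover_ideal_scale)
    show "pd_less n (embed ` ((*) y ` cover_ideal v (U - {u})) \<inter> embed ` ((*) m ` cover_ideal v (U - {u} - T)))"
      unfolding cover_inter using cover_aux_nonzero assms(2) by (intro pd_less_cover_ideal_scale) simp_all
  qed
  then show ?thesis by (simp only: cover_sum)
qed

end

theorem pd_less_cover_ideal:
  assumes "v \<in> {1..l}" "U \<subseteq> {1..l}" "v \<notin> U"
  shows "pd_less (Suc (card U div 2)) (embed ` cover_ideal v U)"
  using assms(2,3)
proof (induction "card U" arbitrary: U rule: less_induct)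
  case less
  have fin: "finite U" using less.prems finite_subset by blast
  show ?case
  proof (cases "\<exists>a\<in>U. \<exists>b\<in>U. a \<noteq> b \<and> {a, b} \<notin> E")
    case False
    then have "cover_ideal v U = R" by (auto simp: cover_ideal_def)
    then show ?thesis using pd_less_mono[OF pd_less_embed_R] by simp
  next
    case True
    then obtain u w where uw: "u \<in> U" "w \<in> U" "u \<noteq> w" "{u, w} \<notin> E" by auto
    let ?T = "{w \<in> U. w \<noteq> u \<and> {u, w} \<notin> E}"
    \<comment> \<open>u has at least the non-neighbour w, so removing u and \<open>?T\<close>
      removes two or more vertices.\<close>
    have "card (U - {u} - ?T) \<le> card (U - {u, w})"
      using uw fin by (intro card_mono) auto
    also have 2: "card (U - {u, w}) = card U - 2"
      using uw fin by (simp add: card_Diff_subset)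
    finally have c: "card (U - {u} - ?T) \<le> card U - 2" .
    have "card {u, w} \<le> card U"
      using uw fin by (intro card_mono) auto
    then have c2: "card U \<ge> 2" using uw by simp
    have "pd_less (Suc (card (U - {u}) div 2)) (embed ` cover_ideal v (U - {u}))"
      using less.prems c2 uw fin by (intro less.hyps) auto
    then have A: "pd_less (Suc (card U div 2)) (embed ` cover_ideal v (U - {u}))"
      by (rule pd_less_mono) (use fin uw in \<open>simp add: div_le_mono\<close>)
    have "pd_less (Suc (card (U - {u} - ?T) div 2)) (embed ` cover_ideal v (U - {u} - ?T))"
      using less.prems c c2 by (intro less.hyps) auto
    \<comment> \<open>Two vertices fewer lower the half by one, which pays for the shorter
      resolution that the intersection needs.\<close>
    then have B: "pd_less (card U div 2) (embed ` cover_ideal v (U - {u} - ?T))"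
      by (rule pd_less_mono) (use c c2 in linarith)
    show ?thesis
      using cover_step[OF assms(1) less.prems uw(1) A B] .
  qed
qed

end

section \<open>Resolutions and projective dimension\<close>

context scalars
begin

text \<open>Unrolls the recursion of \<open>pd_less\<close> into one sequence of ranks and
  generating families, the shape in which \<open>proj_resolution\<close> wants the modules and
  maps.\<close>

lemma free_resolution_exists:
  assumes "pd_less (Suc n) M"
  shows "\<exists>k G. lin_comb (k 0) (G 0) ` free (k 0) = M \<and>
    (\<forall>i. lin_comb (k (Suc i)) (G (Suc i)) ` free (k (Suc i)) = syz (k i) (G i)) \<and> (\<forall>i>n. k i = 0)"
  using assms
proof (induction n arbitrary: M)
  case 0
  then obtain k g where g: "lin_comb k g ` free k = M" and "pd_less 0 (syz k g)"
    by (rule pd_less_SucE)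
  then have s: "syz k g = {\<lambda>_. 0}" by simp
  have free0: "free 0 = {\<lambda>_. 0}" by (auto simp: free_def)
  \<comment> \<open>M is free on g. All later ranks are zero, so g can be repeated as a placeholder
    for the later families.\<close>
  define k' where "k' i = (if i = 0 then k else 0)" for i :: nat
  have 1: "lin_comb (k' (Suc i)) g ` free (k' (Suc i)) = syz (k' i) g" for i
  proof (cases "i = 0")
    case True
    then show ?thesis by (simp add: k'_def free0 s)
  next
    case False
    then have "syz (k' i) g = {\<lambda>_. 0}" by (auto simp: k'_def free0 syz_def)
    then show ?thesis by (simp add: k'_def free0)
  qed
  show ?case
  proof (intro exI[of _ k'] exI[of _ "\<lambda>_. g"] conjI allI impI 1)
    show "lin_comb (k' 0) g ` free (k' 0) = M" using g by (simp add: k'_def)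
  qed (simp add: k'_def)
next
  case (Suc n)
  obtain k g where g: "lin_comb k g ` free k = M" "pd_less (Suc n) (syz k g)"
    using Suc.prems by (rule pd_less_SucE)
  from Suc.IH[OF g(2)] obtain k' G where G: "lin_comb (k' 0) (G 0) ` free (k' 0) = syz k g"
    "\<And>i. lin_comb (k' (Suc i)) (G (Suc i)) ` free (k' (Suc i)) = syz (k' i) (G i)" "\<And>i. i > n \<Longrightarrow> k' i = 0"
    by blast
  show ?case
  proof (intro exI conjI allI impI)
    let ?k = "case_nat k k'" and ?G = "case_nat g G"
    show "lin_comb (?k 0) (?G 0) ` free (?k 0) = M" using g(1) by simp
    show "lin_comb (?k (Suc i)) (?G (Suc i)) ` free (?k (Suc i)) = syz (?k i) (?G i)" for i
      using G(1,2) by (cases i) simp_all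
    show "?k i = 0" if "i > Suc n" for i
      using that G(3) by (cases i) simp_all
  qed
qed

end

section \<open>Free modules over a commutative ring are projective modules\<close>

lemma abelian_group_free_module:
  fixes R (structure)
  assumes "cring R" shows "abelian_group (free_module R I)"
proof -
  interpret cring R by (rule assms)
  have ops: "x \<oplus>\<^bsub>free_module R I\<^esub> y = (\<lambda>i. x i \<oplus> y i)" "\<zero>\<^bsub>free_module R I\<^esub> = (\<lambda>i. \<zero>)" for x y
    by (simp_all add: free_module_def)
  have c: "x i \<in> carrier R" and z: "i \<notin> I \<Longrightarrow> x i = \<zero>" and fin: "finite {i. x i \<noteq> \<zero>}"
    if "x \<in> carrier (free_module R I)" for x i
    using that by (cases "i \<in> I"; simp add: free_module_def)+
  have mem: "x \<in> carrier (free_module R I)"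
    if "\<And>i. x i \<in> carrier R" "\<And>i. i \<notin> I \<Longrightarrow> x i = \<zero>" "finite {i. x i \<noteq> \<zero>}" for x
    using that by (simp add: free_module_def)
  show ?thesis
  proof (rule abelian_groupI)
    fix x y assume x: "x \<in> carrier (free_module R I)" and y: "y \<in> carrier (free_module R I)"
    show "x \<oplus>\<^bsub>free_module R I\<^esub> y \<in> carrier (free_module R I)"
      unfolding ops
    proof (rule mem)
      show "finite {i. x i \<oplus> y i \<noteq> \<zero>}"
        by (rule finite_subset[OF _ finite_UnI[OF fin[OF x] fin[OF y]]]) auto
      show "x i \<oplus> y i \<in> carrier R" for i
        by (intro a_closed c x y)
      show "x i \<oplus> y i = \<zero>" if "i \<notin> I" for i
        using z[OF x that] z[OF y that] by simp
    qed
    show "x \<oplus>\<^bsub>free_module R I\<^esub> y = y \<oplus>\<^bsub>free_module R I\<^esub> x"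
      unfolding ops by (intro ext a_comm c x y)
    show "x \<oplus>\<^bsub>free_module R I\<^esub> y \<oplus>\<^bsub>free_module R I\<^esub> w = x \<oplus>\<^bsub>free_module R I\<^esub> (y \<oplus>\<^bsub>free_module R I\<^esub> w)"
      if w: "w \<in> carrier (free_module R I)" for w
      unfolding ops by (intro ext a_assoc c x y w)
  next
    fix x assume x: "x \<in> carrier (free_module R I)"
    show "\<exists>y\<in>carrier (free_module R I). y \<oplus>\<^bsub>free_module R I\<^esub> x = \<zero>\<^bsub>free_module R I\<^esub>"
    proof (rule bexI)
      show "(\<lambda>i. \<ominus> x i) \<oplus>\<^bsub>free_module R I\<^esub> x = \<zero>\<^bsub>free_module R I\<^esub>"
        unfolding ops by (intro ext l_neg c x)
      show "(\<lambda>i. \<ominus> x i) \<in> carrier (free_module R I)"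
      proof (rule mem)
        show "finite {i. \<ominus> x i \<noteq> \<zero>}"
          by (rule finite_subset[OF _ fin[OF x]]) auto
        show "\<ominus> x i \<in> carrier R" for i
          by (intro a_inv_closed c x)
        show "\<ominus> x i = \<zero>" if "i \<notin> I" for i
          using z[OF x that] by simp
      qed
    qed
    show "\<zero>\<^bsub>free_module R I\<^esub> \<oplus>\<^bsub>free_module R I\<^esub> x = x"
      unfolding ops by (intro ext l_zero c x)
  next
    show "\<zero>\<^bsub>free_module R I\<^esub> \<in> carrier (free_module R I)"
      unfolding ops by (rule mem) simp_all
  qed
qed

lemma module_free_module:
  fixes R (structure)
  assumes "cring R" shows "module R (free_module R I)"
proof -
  interpret cring R by (rule assms)
  have smult: "a \<odot>\<^bsub>free_module R I\<^esub> x = (\<lambda>i. a \<otimes> x i)"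
    "x \<oplus>\<^bsub>free_module R I\<^esub> y = (\<lambda>i. x i \<oplus> y i)" for a x y
    by (simp_all add: free_module_def)
  have c: "x i \<in> carrier R" if "x \<in> carrier (free_module R I)" for x i
    using that by (cases "i \<in> I") (auto simp: free_module_def)
  show ?thesis
  proof (rule moduleI[OF assms abelian_group_free_module[OF assms]])
    fix a x assume a: "a \<in> carrier R" and x: "x \<in> carrier (free_module R I)"
    have "{i. a \<otimes> x i \<noteq> \<zero>} \<subseteq> {i. x i \<noteq> \<zero>}"
      using a by auto
    then have "finite {i. a \<otimes> x i \<noteq> \<zero>}"
      by (rule finite_subset) (use x in \<open>simp add: free_module_def\<close>)
    then show "a \<odot>\<^bsub>free_module R I\<^esub> x \<in> carrier (free_module R I)"
      using a x by (simp add: free_module_def)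
  next
    fix a b x assume *: "a \<in> carrier R" "b \<in> carrier R" "x \<in> carrier (free_module R I)"
    show "(a \<oplus> b) \<odot>\<^bsub>free_module R I\<^esub> x =
        a \<odot>\<^bsub>free_module R I\<^esub> x \<oplus>\<^bsub>free_module R I\<^esub> b \<odot>\<^bsub>free_module R I\<^esub> x"
      unfolding smult by (intro ext l_distr * c)
  next
    fix a x y assume *: "a \<in> carrier R" "x \<in> carrier (free_module R I)" "y \<in> carrier (free_module R I)"
    show "a \<odot>\<^bsub>free_module R I\<^esub> (x \<oplus>\<^bsub>free_module R I\<^esub> y) =
        a \<odot>\<^bsub>free_module R I\<^esub> x \<oplus>\<^bsub>free_module R I\<^esub> a \<odot>\<^bsub>free_module R I\<^esub> y"
      unfolding smult by (intro ext r_distr * c)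
  next
    fix a b x assume *: "a \<in> carrier R" "b \<in> carrier R" "x \<in> carrier (free_module R I)"
    show "(a \<otimes> b) \<odot>\<^bsub>free_module R I\<^esub> x =
        a \<odot>\<^bsub>free_module R I\<^esub> (b \<odot>\<^bsub>free_module R I\<^esub> x)"
      unfolding smult by (intro ext m_assoc * c)
  next
    fix x assume *: "x \<in> carrier (free_module R I)"
    show "\<one> \<odot>\<^bsub>free_module R I\<^esub> x = x"
      unfolding smult by (intro ext l_one * c)
  qed
qed

text \<open>The definition of \<^const>\<open>projective_module\<close> asks for basis indices that are elements of the
  module, so the standard basis is indexed by its own vectors.\<close>

lemma projective_free_module:
  fixes R (structure)
  assumes "cring R" and one: "\<one> \<noteq> \<zero>"
  shows "projective_module R (free_module R I)"
proof -
  interpret cring R by (rule assms)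
  let ?b = "\<lambda>j i. if i = j then \<one> else \<zero>"
  \<comment> \<open>\<open>\<one> \<noteq> \<zero>\<close> is what keeps the basis vectors of
    distinct indices apart.\<close>
  have inj: "inj ?b"
  proof (rule injI)
    fix j j' assume "?b j = ?b j'"
    from fun_cong[OF this, of j] one show "j = j'" by (simp split: if_splits)
  qed
  let ?s = "\<lambda>x m. if m \<in> ?b ` I then x (inv_into UNIV ?b m) else \<zero>"
  let ?p = "\<lambda>y j. if j \<in> I then y (?b j) else \<zero>"
  have inv_b [simp]: "inv_into UNIV ?b (?b j) = j" for j
    using inj by (rule inv_f_f)
  have s: "?s \<in> linear_maps R (free_module R I) (free_module R (?b ` I))"
    unfolding linear_maps_def
  proof (intro CollectI conjI ballI)
    fix x assume x: "x \<in> carrier (free_module R I)"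
    have "{m. ?s x m \<noteq> \<zero>} \<subseteq> ?b ` {j. x j \<noteq> \<zero>}" by auto
    moreover have "finite {j. x j \<noteq> \<zero>}" using x by (simp add: free_module_def)
    ultimately have "finite {m. ?s x m \<noteq> \<zero>}"
      using finite_subset by blast
    then show "?s x \<in> carrier (free_module R (?b ` I))"
      using x by (simp add: free_module_def)
  qed (rule ext, simp add: free_module_def)+
  have p: "?p \<in> linear_maps R (free_module R (?b ` I)) (free_module R I)"
    unfolding linear_maps_def
  proof (intro CollectI conjI ballI)
    fix y assume y: "y \<in> carrier (free_module R (?b ` I))"
    have "?b ` {j. ?p y j \<noteq> \<zero>} \<subseteq> {m. y m \<noteq> \<zero>}" by auto
    moreover have "finite {m. y m \<noteq> \<zero>}" using y by (simp add: free_module_def)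
    ultimately have "finite (?b ` {j. ?p y j \<noteq> \<zero>})"
      using finite_subset by blast
    then have "finite {j. ?p y j \<noteq> \<zero>}"
      by (rule finite_imageD) (rule inj_on_subset[OF inj], simp)
    then show "?p y \<in> carrier (free_module R I)"
      using y by (simp add: free_module_def)
  qed (rule ext, simp add: free_module_def)+
  have ps: "\<forall>x\<in>carrier (free_module R I). ?p (?s x) = x"
  proof (intro ballI ext)
    fix x j assume "x \<in> carrier (free_module R I)"
    then have "x j = \<zero>" if "j \<notin> I" using that by (simp add: free_module_def)
    then show "?p (?s x) j = x j" by (cases "j \<in> I") simp_all
  qed
  show ?thesis
    unfolding projective_module_def
    by (intro conjI module_free_module[OF assms(1)] exI)
      (rule bexI[OF _ s], rule bexI[OF _ p], rule ps)
qed

section \<open>From explicit free resolutions to \<open>proj_dim\<close>\<close>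

lemma poly_ring_simps [simp]:
  "carrier (poly_ring l) = polys l" "\<zero>\<^bsub>poly_ring l\<^esub> = 0" "\<one>\<^bsub>poly_ring l\<^esub> = 1"
  "p \<oplus>\<^bsub>poly_ring l\<^esub> q = p + q" "p \<otimes>\<^bsub>poly_ring l\<^esub> q = p * q"
  by (simp_all add: polys_def) (simp_all add: poly_ring_def)

lemma cring_poly_ring: "cring (poly_ring l :: 'k::field mpoly ring)"
proof (rule cringI)
  show "abelian_group (poly_ring l :: 'k mpoly ring)"
  proof (rule abelian_groupI)
    fix p :: "'k mpoly" assume "p \<in> carrier (poly_ring l)"
    then show "\<exists>q\<in>carrier (poly_ring l). q \<oplus>\<^bsub>poly_ring l\<^esub> p = \<zero>\<^bsub>poly_ring l\<^esub>"
      using polys_uminus[of p l] by (intro bexI[of _ "- p"]) simp_all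
  qed (simp_all add: polys_add polys_zero algebra_simps)
  show "Group.comm_monoid (poly_ring l :: 'k mpoly ring)"
    by (rule comm_monoidI) (simp_all add: polys_mult polys_one algebra_simps)
qed (simp add: algebra_simps)

text \<open>Exactness is built in: the image of each map is by construction the syzygy module that
  is the kernel of the preceding map. What is left is to move the coefficient vectors into the type
  fixed by \<open>proj_dim\<close> and to continue the augmentation from M to N along
  \<Psi>.\<close>

lemma proj_dim_le_pd_less:
  fixes R :: "'k::field mpoly set" and N :: "('k mpoly, 'm) module" and \<Psi> :: "(nat \<Rightarrow> 'k mpoly) \<Rightarrow> 'm"
  assumes R: "R = polys l" and sub: "scalars.submod R M" and pd: "scalars.pd_less R (Suc n) M"
    and bij: "bij_betw \<Psi> M (carrier N)"
    and add: "\<And>x y. x \<in> M \<Longrightarrow> y \<in> M \<Longrightarrow> \<Psi> (\<lambda>i. x i + y i) = \<Psi> x \<oplus>\<^bsub>N\<^esub> \<Psi> y"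
    and smult: "\<And>a x. a \<in> R \<Longrightarrow> x \<in> M \<Longrightarrow> \<Psi> (\<lambda>i. a * x i) = a \<odot>\<^bsub>N\<^esub> \<Psi> x"
    and zero: "\<Psi> (\<lambda>_. 0) = \<zero>\<^bsub>N\<^esub>"
  shows "proj_dim (poly_ring l) N \<le> enat n"
proof -
  interpret graph_polys l "{}" R by unfold_locales (rule R)
  from free_resolution_exists[OF pd] obtain k G where G: "lin_comb (k 0) (G 0) ` free (k 0) = M"
    "\<And>i. lin_comb (k (Suc i)) (G (Suc i)) ` free (k (Suc i)) = syz (k i) (G i)" "\<And>i. i > n \<Longrightarrow> k i = 0"
    by blast
  \<comment> \<open>Coefficient vectors are placed on the summand \<open>nat\<close> of the index
    type and extended by zero; \<pi> reads them back.\<close>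
  define \<iota> :: "(nat \<Rightarrow> 'k mpoly) \<Rightarrow> nat + 'k mpoly + 'm \<Rightarrow> 'k mpoly"
    where "\<iota> x j = (case j of Inl i \<Rightarrow> x i | Inr _ \<Rightarrow> 0)" for x j
  define \<pi> :: "(nat + 'k mpoly + 'm \<Rightarrow> 'k mpoly) \<Rightarrow> nat \<Rightarrow> 'k mpoly" where "\<pi> f i = f (Inl i)" for f i
  define P :: "nat \<Rightarrow> ('k mpoly, nat + 'k mpoly + 'm \<Rightarrow> 'k mpoly) module"
    where "P i = free_module (poly_ring l) (Inl ` {..<k i})" for i
  define d where "d i f = \<iota> (lin_comb (k (Suc i)) (G (Suc i)) (\<pi> f))" for i f
  define e where "e f = \<Psi> (lin_comb (k 0) (G 0) (\<pi> f))" for f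
  have \<pi>\<iota> [simp]: "\<pi> (\<iota> x) = x" for x by (rule ext) (simp add: \<pi>_def \<iota>_def)
  note Rc = R[symmetric]
  have carrier_P: "carrier (P i) = \<iota> ` free (k i)" for i
  proof (intro equalityI subsetI)
    fix f assume "f \<in> carrier (P i)"
    then have f: "\<And>j. j < k i \<Longrightarrow> f (Inl j) \<in> R" "\<And>j. j \<notin> Inl ` {..<k i} \<Longrightarrow> f j = 0"
      by (auto simp: P_def free_module_def Rc)
    have "f j = \<iota> (\<pi> f) j" for j
      using f(2)[of j] by (cases j) (auto simp: \<iota>_def \<pi>_def)
    then have "f = \<iota> (\<pi> f)" by (rule ext)
    moreover have "\<pi> f \<in> free (k i)"
      unfolding free_def \<pi>_def
    proof (intro CollectI conjI allI impI)
      show "f (Inl j) \<in> R" if "j < k i" for j using that by (rule f(1))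
      show "f (Inl j) = 0" if "k i \<le> j" for j using that by (intro f(2)) auto
    qed
    ultimately show "f \<in> \<iota> ` free (k i)" by blast
  next
    fix f assume "f \<in> \<iota> ` free (k i)"
    then obtain x where x: "x \<in> free (k i)" "f = \<iota> x" by blast
    have z: "\<iota> x j = 0" if "j \<notin> Inl ` {..<k i}" for j
    proof (cases j)
      case (Inl a)
      with that have "a \<ge> k i" by (metis imageI lessThan_iff not_le)
      then show ?thesis using x(1) Inl by (simp add: \<iota>_def free_def)
    qed (simp add: \<iota>_def)
    then have "{j. \<iota> x j \<noteq> 0} \<subseteq> Inl ` {..<k i}" by blast
    then have "finite {j. \<iota> x j \<noteq> 0}" by (rule finite_subset) simp
    moreover have "\<iota> x (Inl j) \<in> R" for j
      using freeD[OF x(1)] by (simp add: \<iota>_def)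
    ultimately show "f \<in> carrier (P i)"
      using z x(2) by (auto simp: P_def free_module_def Rc)
  qed
  have \<iota>_inj: "\<iota> x = \<iota> y \<longleftrightarrow> x = y" for x y by (metis \<pi>\<iota>)
  have zero_P: "\<zero>\<^bsub>P i\<^esub> = \<iota> (\<lambda>_. 0)" for i
    by (auto simp: P_def free_module_def \<iota>_def fun_eq_iff split: sum.split)
  have add_P: "\<iota> x \<oplus>\<^bsub>P i\<^esub> \<iota> y = \<iota> (\<lambda>j. x j + y j)" for i x y
    by (auto simp: P_def free_module_def \<iota>_def fun_eq_iff split: sum.split)
  have smult_P: "a \<odot>\<^bsub>P i\<^esub> \<iota> x = \<iota> (\<lambda>j. a * x j)" for i a x
    by (auto simp: P_def free_module_def \<iota>_def fun_eq_iff split: sum.split)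
  have \<Psi>_zero: "\<Psi> x = \<zero>\<^bsub>N\<^esub> \<longleftrightarrow> x = (\<lambda>_. 0)" if "x \<in> M" for x
    using bij_betw_imp_inj_on[OF bij] that submod_zero[OF sub] zero by (metis inj_onD)
  have in_M: "lin_comb (k 0) (G 0) x \<in> M" if "x \<in> free (k 0)" for x
    using G(1) that by blast
  have in_syz: "lin_comb (k (Suc i)) (G (Suc i)) x \<in> syz (k i) (G i)" if "x \<in> free (k (Suc i))" for i x
    using G(2) that by blast
  have syz_free: "x \<in> free (k i)" if "x \<in> syz (k i) (G i)" for i x
    using that by (simp add: syz_def)
  have d_image: "d i ` carrier (P (Suc i)) = \<iota> ` syz (k i) (G i)" for i
    unfolding carrier_P G(2)[symmetric] by (simp add: d_def image_image)
  have "proj_resolution (poly_ring l) N n P d e"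
    unfolding proj_resolution_def
  proof (intro conjI allI impI)
    show "projective_module (poly_ring l) (P i)" for i
      unfolding P_def by (rule projective_free_module[OF cring_poly_ring]) simp
    show "carrier (P i) = {\<zero>\<^bsub>P i\<^esub>}" if "i > n" for i
    proof -
      have "free 0 = {\<lambda>_. 0}" by (auto simp: free_def)
      then show ?thesis by (simp add: carrier_P zero_P G(3)[OF that])
    qed
    show "d i \<in> linear_maps (poly_ring l) (P (Suc i)) (P i)" for i
      unfolding linear_maps_def
    proof (intro CollectI conjI ballI)
      fix f assume "f \<in> carrier (P (Suc i))"
      then obtain x where x: "x \<in> free (k (Suc i))" "f = \<iota> x" unfolding carrier_P by blast
      show "d i f \<in> carrier (P i)"
        unfolding carrier_P d_def x(2) \<pi>\<iota> by (intro imageI syz_free in_syz x(1))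
      show "d i (f \<oplus>\<^bsub>P (Suc i)\<^esub> h) = d i f \<oplus>\<^bsub>P i\<^esub> d i h" if "h \<in> carrier (P (Suc i))" for h
        using that x(2) by (auto simp: carrier_P d_def add_P lin_comb_add)
      show "d i (a \<odot>\<^bsub>P (Suc i)\<^esub> f) = a \<odot>\<^bsub>P i\<^esub> d i f" for a
        by (simp add: x(2) d_def smult_P lin_comb_smult)
    qed
    show "e \<in> linear_maps (poly_ring l) (P 0) N"
      unfolding linear_maps_def
    proof (intro CollectI conjI ballI)
      fix f assume "f \<in> carrier (P 0)"
      then obtain x where x: "x \<in> free (k 0)" "f = \<iota> x" unfolding carrier_P by blast
      show "e f \<in> carrier N"
        unfolding e_def x(2) \<pi>\<iota> by (intro bij_betw_apply[OF bij] in_M x(1))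
      show "e (f \<oplus>\<^bsub>P 0\<^esub> h) = e f \<oplus>\<^bsub>N\<^esub> e h" if h: "h \<in> carrier (P 0)" for h
      proof -
        from h obtain y where y: "y \<in> free (k 0)" "h = \<iota> y" unfolding carrier_P by blast
        show ?thesis
          using add[OF in_M[OF x(1)] in_M[OF y(1)]] by (simp add: x(2) y(2) e_def add_P lin_comb_add)
      qed
      show "e (a \<odot>\<^bsub>P 0\<^esub> f) = a \<odot>\<^bsub>N\<^esub> e f" if "a \<in> carrier (poly_ring l)" for a
      proof -
        have "a \<in> R" using that by (simp add: Rc)
        then show ?thesis
          using smult[OF _ in_M[OF x(1)], of a] by (simp add: x(2) e_def smult_P lin_comb_smult)
      qed
    qed
    show "e ` carrier (P 0) = carrier N"
    proof -
      have "e ` carrier (P 0) = \<Psi> ` (lin_comb (k 0) (G 0) ` free (k 0))"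
        by (simp add: carrier_P e_def image_image)
      then show ?thesis
        using bij_betw_imp_surj_on[OF bij] by (simp only: G(1))
    qed
    show "d 0 ` carrier (P 1) = {x \<in> carrier (P 0). e x = \<zero>\<^bsub>N\<^esub>}"
    proof -
      have "e (\<iota> x) = \<zero>\<^bsub>N\<^esub> \<longleftrightarrow> lin_comb (k 0) (G 0) x = (\<lambda>_. 0)" if "x \<in> free (k 0)" for x
        using \<Psi>_zero[OF in_M[OF that]] by (simp add: e_def)
      then show ?thesis
        unfolding One_nat_def d_image unfolding carrier_P syz_def by blast
    qed
    show "d (Suc i) ` carrier (P (Suc (Suc i))) = {x \<in> carrier (P (Suc i)). d i x = \<zero>\<^bsub>P i\<^esub>}" for i
    proof -
      have "d i (\<iota> x) = \<zero>\<^bsub>P i\<^esub> \<longleftrightarrow> lin_comb (k (Suc i)) (G (Suc i)) x = (\<lambda>_. 0)" for x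
        by (simp add: d_def zero_P \<iota>_inj)
      then show ?thesis
        unfolding d_image unfolding carrier_P syz_def by blast
    qed
  qed
  then show ?thesis
    unfolding proj_dim_def
    by (intro Inf_lower CollectI exI[of _ n] conjI refl exI[of _ P] exI[of _ d] exI[of _ e])
qed

section \<open>Logarithmic forms of graphic arrangements\<close>

context graph_polys
begin

text \<open>On the vertex set \<open>W\<close>, these are the numerators \<open>Q(\<A>) \<omega>\<close> of the logarithmic 1-forms \<open>\<omega>\<close>,
  with all \<open>x\<^sub>1, \<dots>, x\<^sub>l\<close> allowed in the coefficients.\<close>

definition log_mod :: "nat set \<Rightarrow> (nat \<Rightarrow> 'k mpoly) set" where
  "log_mod W = {\<eta>. (\<forall>i\<in>W. \<eta> i \<in> R) \<and> (\<forall>i. i \<notin> W \<longrightarrow> \<eta> i = 0) \<and>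
     (\<forall>a\<in>W. \<forall>b\<in>W. a \<noteq> b \<and> {a, b} \<in> E \<longrightarrow>
        (\<forall>i. i \<noteq> a \<and> i \<noteq> b \<longrightarrow> lin a b dvd \<eta> i) \<and> lin a b dvd \<eta> a + \<eta> b)}"

lemma log_modD:
  assumes "\<eta> \<in> log_mod W"
  shows "\<eta> i \<in> R" "i \<notin> W \<Longrightarrow> \<eta> i = 0"
    and "a \<in> W \<Longrightarrow> b \<in> W \<Longrightarrow> a \<noteq> b \<Longrightarrow> {a, b} \<in> E \<Longrightarrow> i \<noteq> a \<Longrightarrow> i \<noteq> b \<Longrightarrow> lin a b dvd \<eta> i"
    and "a \<in> W \<Longrightarrow> b \<in> W \<Longrightarrow> a \<noteq> b \<Longrightarrow> {a, b} \<in> E \<Longrightarrow> lin a b dvd \<eta> a + \<eta> b"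
proof -
  show "\<eta> i \<in> R"
    using assms unfolding log_mod_def by (cases "i \<in> W") auto
qed (use assms in \<open>auto simp: log_mod_def\<close>)

lemma log_modI:
  assumes "\<And>i. i \<in> W \<Longrightarrow> \<eta> i \<in> R" "\<And>i. i \<notin> W \<Longrightarrow> \<eta> i = 0"
    and "\<And>a b i. a \<in> W \<Longrightarrow> b \<in> W \<Longrightarrow> a \<noteq> b \<Longrightarrow> {a, b} \<in> E \<Longrightarrow> i \<noteq> a \<Longrightarrow> i \<noteq> b \<Longrightarrow> lin a b dvd \<eta> i"
    and "\<And>a b. a \<in> W \<Longrightarrow> b \<in> W \<Longrightarrow> a \<noteq> b \<Longrightarrow> {a, b} \<in> E \<Longrightarrow> lin a b dvd \<eta> a + \<eta> b"
  shows "\<eta> \<in> log_mod W"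
  unfolding log_mod_def using assms by blast

lemma submod_log_mod: "submod (log_mod W)"
  unfolding submod_def
proof (intro conjI ballI)
  show "(\<lambda>_. 0) \<in> log_mod W"
    by (rule log_modI) simp_all
next
  fix x y assume x: "x \<in> log_mod W" and y: "y \<in> log_mod W"
  show "(\<lambda>i. x i + y i) \<in> log_mod W"
  proof (rule log_modI)
    fix a b i assume ab: "a \<in> W" "b \<in> W" "a \<noteq> b" "{a, b} \<in> E"
    show "lin a b dvd x i + y i" if "i \<noteq> a" "i \<noteq> b"
      using log_modD(3)[OF x ab that] log_modD(3)[OF y ab that] by (rule dvd_add)
    have "lin a b dvd (x a + x b) + (y a + y b)"
      using log_modD(4)[OF x ab] log_modD(4)[OF y ab] by (rule dvd_add)
    then show "lin a b dvd (x a + y a) + (x b + y b)"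
      by (simp add: algebra_simps)
  qed (simp_all add: log_modD[OF x] log_modD[OF y])
next
  fix c x assume c: "c \<in> R" and x: "x \<in> log_mod W"
  show "(\<lambda>i. c * x i) \<in> log_mod W"
  proof (rule log_modI)
    fix a b i assume ab: "a \<in> W" "b \<in> W" "a \<noteq> b" "{a, b} \<in> E"
    show "lin a b dvd c * x i" if "i \<noteq> a" "i \<noteq> b"
      using log_modD(3)[OF x ab that] by (rule dvd_mult)
    show "lin a b dvd c * x a + c * x b"
      using log_modD(4)[OF x ab] unfolding distrib_left[symmetric] by (rule dvd_mult)
  qed (simp_all add: log_modD[OF x] c)
qed

section \<open>Removing a vertex v: kernel and image of the dx_v-coefficient\<close>

context
  fixes v :: nat and W N :: "nat set" and T :: "(nat \<times> nat) set" and P Q :: "'k mpoly"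
  assumes W: "W \<subseteq> {1..l}" and v: "v \<in> W"
  defines "N \<equiv> {u \<in> W. u \<noteq> v \<and> {v, u} \<in> E}"
  defines "T \<equiv> {(a, b). a \<in> W - {v} \<and> b \<in> W - {v} \<and> a < b \<and> {a, b} \<in> E}"
  defines "P \<equiv> \<Prod>u\<in>N. lin v u" and "Q \<equiv> \<Prod>(a, b)\<in>T. lin a b"
begin

lemma N_mem: "u \<in> N \<longleftrightarrow> u \<in> W \<and> u \<noteq> v \<and> {v, u} \<in> E"
  by (simp add: N_def)

lemma v_range: "v \<in> {1..l}" and N_range: "N \<subseteq> {1..l}" and v_notin_N: "v \<notin> N"
  and finite_N: "finite N" and finite_T: "finite T"
proof -
  have "finite W" using W finite_subset by blast
  then show "finite N" by (simp add: N_def)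
  have "T \<subseteq> W \<times> W" by (auto simp: T_def)
  then show "finite T" using \<open>finite W\<close> finite_subset by blast
qed (use W v in \<open>auto simp: N_def\<close>)

lemma P_R: "P \<in> R"
  unfolding P_def using v_range N_range by (intro prod_R lin_R) auto

lemma P_nonzero: "P \<noteq> 0"
  unfolding P_def using finite_N by (simp add: N_mem)

lemma Q_R: "Q \<in> R"
  unfolding Q_def using W by (intro prod_R) (auto simp: T_def intro!: lin_R)

lemma Q_nonzero: "Q \<noteq> 0"
  unfolding Q_def using finite_T by (auto simp: T_def)

lemma not_lin_dvd_P:
  assumes "a \<noteq> v" "b \<noteq> v" shows "\<not> lin a b dvd P"
proof -
  have "\<not> lin a b dvd (lin v u :: 'k mpoly)" if "u \<in> N" for u
    using assms that by (auto simp: lin_dvd_lin_iff N_mem doubleton_eq_iff)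
  then show ?thesis
    by (simp add: P_def lin_dvd_prod_iff[OF finite_N])
qed

lemma lin_dvd_P: "u \<in> N \<Longrightarrow> lin v u dvd P" "u \<in> N \<Longrightarrow> lin u v dvd P"
  unfolding P_def lin_dvd_commute[of u v] by (rule dvd_prodI[OF finite_N]; simp)+

lemma lin_dvd_Q:
  assumes "a \<in> W - {v}" "b \<in> W - {v}" "a \<noteq> b" "{a, b} \<in> E"
  shows "lin a b dvd Q"
proof -
  have *: "lin c d dvd Q" if "(c, d) \<in> T" for c d
    unfolding Q_def using dvd_prodI[OF finite_T that, of "\<lambda>(a, b). lin a b"] by simp
  show ?thesis
  proof (cases "a < b")
    case True
    then show ?thesis using assms by (intro *) (simp add: T_def)
  next
    case False
    then have "lin b a dvd Q" using assms by (intro *) (simp add: T_def insert_commute)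
    then show ?thesis by (simp only: lin_dvd_commute)
  qed
qed

lemma Q_dvd:
  assumes "\<And>a b. (a, b) \<in> T \<Longrightarrow> lin a b dvd p" shows "Q dvd p"
proof -
  have "(\<Prod>t\<in>T. lin (fst t) (snd t)) dvd p"
  proof (rule prod_lin_dvd[OF finite_T])
    fix t t' assume "t \<in> T" "t' \<in> T" "t \<noteq> t'"
    then show "\<not> lin (fst t) (snd t) dvd (lin (fst t') (snd t') :: 'k mpoly)"
      by (auto simp: T_def lin_dvd_lin_iff doubleton_eq_iff)
  qed (use assms in auto)
  then show ?thesis by (simp add: Q_def case_prod_unfold)
qed

text \<open>If \<open>\<eta> v = 0\<close>, the sum condition at an edge v u makes x_v - x_u divide
  \<open>\<eta> u\<close>, and the other coefficients are divisible anyway. So P, the share of the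
  edges at v in the denominator, divides \<eta>. The conditions at the remaining edges survive the
  division because x_a - x_b does not divide P.\<close>

lemma kernel_eq: "{\<eta> \<in> log_mod W. embed (\<eta> v) = (\<lambda>_. 0)} = (\<lambda>\<eta> i. P * \<eta> i) ` log_mod (W - {v})"
proof (intro equalityI subsetI)
  fix \<eta> assume "\<eta> \<in> {\<eta> \<in> log_mod W. embed (\<eta> v) = (\<lambda>_. 0)}"
  then have \<eta>: "\<eta> \<in> log_mod W" and v0: "\<eta> v = 0"
    by (simp_all flip: embed_zero)
  have "P dvd \<eta> i" for i
    unfolding P_def
  proof (rule prod_lin_dvd[OF finite_N])
    fix u assume u: "u \<in> N"
    then have u': "u \<in> W" "v \<noteq> u" "{v, u} \<in> E" by (auto simp: N_mem)
    show "lin v u dvd \<eta> i"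
      using log_modD(3)[OF \<eta> v u', of i] log_modD(4)[OF \<eta> v u'] v0
      by (cases "i = v"; cases "i = u") auto
  next
    fix u u' assume "u \<in> N" "u' \<in> N" "u \<noteq> u'"
    then show "\<not> lin v u dvd (lin v u' :: 'k mpoly)"
      by (auto simp: lin_dvd_lin_iff N_mem doubleton_eq_iff)
  qed
  then have "\<forall>i. \<exists>q. \<eta> i = P * q" by (auto simp: dvd_def)
  then obtain \<theta> where \<theta>: "\<And>i. \<eta> i = P * \<theta> i" by metis
  have "\<theta> \<in> log_mod (W - {v})"
  proof (rule log_modI)
    show "\<theta> i \<in> R" for i
      using log_modD(1)[OF \<eta>, of i] P_R P_nonzero unfolding \<theta> by (rule quotient_R)
    show "\<theta> i = 0" if "i \<notin> W - {v}" for i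
      using that log_modD(2)[OF \<eta>, of i] v0 \<theta>[of i] P_nonzero by (cases "i = v") auto
  next
    fix a b i assume ab: "a \<in> W - {v}" "b \<in> W - {v}" "a \<noteq> b" "{a, b} \<in> E"
    then have ab': "a \<in> W" "b \<in> W" "a \<noteq> b" "{a, b} \<in> E" and nP: "\<not> lin a b dvd P"
      using not_lin_dvd_P[of a b] by auto
    show "lin a b dvd \<theta> i" if "i \<noteq> a" "i \<noteq> b"
      using log_modD(3)[OF \<eta> ab' that] nP unfolding \<theta> by (simp add: lin_dvd_mult_iff)
    show "lin a b dvd \<theta> a + \<theta> b"
      using log_modD(4)[OF \<eta> ab'] nP unfolding \<theta> distrib_left[symmetric]
      by (simp add: lin_dvd_mult_iff)
  qed
  moreover have "\<eta> = (\<lambda>i. P * \<theta> i)"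
    using \<theta> by (rule ext)
  ultimately show "\<eta> \<in> (\<lambda>\<eta> i. P * \<eta> i) ` log_mod (W - {v})"
    by blast
next
  fix \<eta> assume "\<eta> \<in> (\<lambda>\<eta> i. P * \<eta> i) ` log_mod (W - {v})"
  then obtain \<theta> where \<theta>: "\<theta> \<in> log_mod (W - {v})" "\<eta> = (\<lambda>i. P * \<theta> i)"
    by blast
  have v0: "\<theta> v = 0" using log_modD(2)[OF \<theta>(1)] by simp
  have "\<eta> \<in> log_mod W"
    unfolding \<theta>(2)
  proof (rule log_modI)
    show "P * \<theta> i \<in> R" for i
      using P_R log_modD(1)[OF \<theta>(1)] by (rule mult_R)
    show "P * \<theta> i = 0" if "i \<notin> W" for i
      using that log_modD(2)[OF \<theta>(1)] by simp
  next
    fix a b i assume ab: "a \<in> W" "b \<in> W" "a \<noteq> b" "{a, b} \<in> E"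
    show "lin a b dvd P * \<theta> i" if "i \<noteq> a" "i \<noteq> b"
    proof (cases "v \<in> {a, b}")
      case True
      then have "lin a b dvd P"
        using ab lin_dvd_P by (auto simp: N_mem insert_commute)
      then show ?thesis by (rule dvd_mult2)
    next
      case False
      then have "lin a b dvd \<theta> i"
        using log_modD(3)[OF \<theta>(1), of a b i] ab that by simp
      then show ?thesis by (rule dvd_mult)
    qed
    have "lin a b dvd P * (\<theta> a + \<theta> b)"
    proof (cases "v \<in> {a, b}")
      case True
      then have "lin a b dvd P"
        using ab lin_dvd_P by (auto simp: N_mem insert_commute)
      then show ?thesis by (rule dvd_mult2)
    next
      case False
      then have "lin a b dvd \<theta> a + \<theta> b"
        using log_modD(4)[OF \<theta>(1), of a b] ab by simp
      then show ?thesis by (rule dvd_mult)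
    qed
    then show "lin a b dvd P * \<theta> a + P * \<theta> b"
      by (simp only: distrib_left)
  qed
  moreover have "embed (\<eta> v) = (\<lambda>_. 0)"
    by (simp add: \<theta>(2) v0 embed_zero)
  ultimately show "\<eta> \<in> {\<eta> \<in> log_mod W. embed (\<eta> v) = (\<lambda>_. 0)}" by blast
qed

text \<open>No edge in T contains v, so Q divides \<open>\<eta> v\<close>. For non-adjacent u and w
  in N, the edge v u makes \<open>\<eta> v + \<eta> u\<close> vanish on x_u = x_v, and the edge v w
  makes \<open>\<eta> u\<close> vanish on x_w = x_v. On the intersection of the two hyperplanes
  \<open>\<eta> v\<close> vanishes, and Q does not.\<close>

lemma coefficient_mem:
  assumes \<eta>: "\<eta> \<in> log_mod W"
  shows "\<eta> v \<in> (*) Q ` cover_ideal v N"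
proof -
  have "Q dvd \<eta> v"
    by (rule Q_dvd) (rule log_modD(3)[OF \<eta>], auto simp: T_def)
  then obtain g where g: "\<eta> v = Q * g" by (rule dvdE)
  have "g \<in> cover_ideal v N"
    unfolding cover_ideal_def
  proof (intro CollectI conjI ballI impI)
    show "g \<in> R"
      using log_modD(1)[OF \<eta>, of v] Q_R Q_nonzero unfolding g by (rule quotient_R)
    fix u w assume uw: "u \<in> N" "w \<in> N" "u \<noteq> w \<and> {u, w} \<notin> E"
    then have u: "u \<in> W" "v \<noteq> u" "{v, u} \<in> E" and w: "w \<in> W" "v \<noteq> w" "{v, w} \<in> E"
      by (auto simp: N_mem)
    have "lin u v dvd \<eta> v + \<eta> u"
      using log_modD(4)[OF \<eta> v u] by (simp only: lin_dvd_commute)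
    then have "identify {w} v (identify {u} v (\<eta> v + \<eta> u)) = 0"
      by (simp only: lin_dvd_iff identify_simps)
    then have 1: "identify {u, w} v (\<eta> v + \<eta> u) = 0"
      unfolding identify_identify by (simp only: Un_insert_left Un_empty_left insert_commute)
    have "lin w v dvd \<eta> u"
      using log_modD(3)[OF \<eta> v w, of u] u uw by (simp add: lin_dvd_commute)
    then have "identify {u} v (identify {w} v (\<eta> u)) = 0"
      by (simp only: lin_dvd_iff identify_simps)
    then have 2: "identify {u, w} v (\<eta> u) = 0"
      unfolding identify_identify by (simp only: Un_insert_left Un_empty_left)
    have "identify {u, w} v Q * identify {u, w} v g = 0"
      using 1 2 by (simp add: g)
    \<comment> \<open>A factor x_a - x_b of Q could become zero only for {a, b} = {u, w}, since v is
      not an end of an edge in T; but u and w are not adjacent.\<close>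
    moreover have "identify {u, w} v Q \<noteq> 0"
    proof -
      have "identify {u, w} v (lin a b :: 'k mpoly) \<noteq> 0" if "(a, b) \<in> T" for a b
        using that uw by (auto simp: T_def insert_commute)
      then show ?thesis
        using finite_T by (auto simp: Q_def case_prod_unfold)
    qed
    ultimately show "identify {u, w} v g = 0" by simp
  qed
  then show ?thesis using g by blast
qed

text \<open>The lift of \<open>g\<close> is \<open>g / \<Prod>\<^sub>u (x\<^sub>v - x\<^sub>u) dx\<^sub>v - \<Sum>\<^sub>u r\<^sub>u / (x\<^sub>v - x\<^sub>u) dx\<^sub>u\<close>, where the \<open>r\<^sub>u\<close> are the
  coefficients of the partial fraction decomposition of \<open>g / \<Prod>\<^sub>u (x\<^sub>v - x\<^sub>u)\<close> in \<open>x\<^sub>v\<close>.  The vanishing of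
  \<open>g\<close> makes \<open>r\<^sub>u\<close> regular along \<open>x\<^sub>u = x\<^sub>w\<close> when \<open>w\<close> is not adjacent to \<open>u\<close>.\<close>

lemma coefficient_lift:
  assumes g: "g \<in> cover_ideal v N"
  obtains \<eta> where "\<eta> \<in> log_mod W" "\<eta> v = Q * g"
proof -
  \<comment> \<open>In the notation above, \<open>r\<^sub>u = G u / D u\<close>, and
    \<open>P' u\<close> is P without the factor x_v - x_u. Clearing the denominator by
    \<open>P * Q\<close> turns the coefficient of dx_u into \<open>- Q * P' u * G u / D u\<close>,
    which is \<open>- q u\<close> below.\<close>
  define D :: "nat \<Rightarrow> 'k mpoly" where "D u = (\<Prod>w\<in>N - {u}. lin u w)" for u
  define P' :: "nat \<Rightarrow> 'k mpoly" where "P' u = (\<Prod>w\<in>N - {u}. lin v w)" for u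
  define G where "G u = identify {v} u g" for u
  have gR: "g \<in> R" using g by (simp add: cover_ideal_def)
  have fin: "finite (N - A)" for A using finite_N by simp
  have DR: "D u \<in> R" if "u \<in> N" for u
    unfolding D_def using that N_range by (intro prod_R lin_R) auto
  have D0: "D u \<noteq> 0" for u
    unfolding D_def using fin[of "{u}"] by (auto simp: prod_zero_iff)
  have P'R: "P' u \<in> R" for u
    unfolding P'_def using v_range N_range by (intro prod_R lin_R) auto
  have GR: "G u \<in> R" if "u \<in> N" for u
    unfolding G_def using gR N_range that by (intro identify_R) auto
  \<comment> \<open>The poles of \<open>r\<^sub>u\<close> along x_u = x_w are cancelled by Q if u
    and w are adjacent, and by the vanishing of g on x_u = x_w = x_v if they are not.\<close>
  have "D u dvd Q * P' u * G u" if u: "u \<in> N" for u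
    unfolding D_def
  proof (rule prod_lin_dvd[OF fin])
    fix w assume w: "w \<in> N - {u}"
    show "lin u w dvd Q * P' u * G u"
    proof (cases "{u, w} \<in> E")
      case True
      then have "lin u w dvd Q"
        using u w by (intro lin_dvd_Q) (auto simp: N_mem)
      then show ?thesis by (simp add: mult.assoc)
    next
      case False
      then have "identify {u, w} v g = 0"
        using g u w by (auto simp: cover_ideal_def)
      then have "identify {v} u (identify {u, w} v g) = 0" by simp
      \<comment> \<open>The vanishing of g is rewritten with x_u as the remaining coordinate,
        because x_v has been eliminated from \<open>G u\<close>.\<close>
      moreover have "insert v ({u, w} - {u}) = {w} \<union> {v}" using w by auto
      ultimately have "identify {w} u (G u) = 0"
        using u v_notin_N w by (simp add: identify_retarget G_def identify_identify)
      then have "lin u w dvd G u"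
        by (subst lin_dvd_commute) (simp only: lin_dvd_iff)
      then show ?thesis by (rule dvd_mult)
    qed
  next
    fix w w' assume "w \<in> N - {u}" "w' \<in> N - {u}" "w \<noteq> w'"
    then show "\<not> lin u w dvd (lin u w' :: 'k mpoly)"
      by (auto simp: lin_dvd_lin_iff doubleton_eq_iff)
  qed
  then have "\<forall>u\<in>N. \<exists>q. Q * P' u * G u = D u * q" by (auto simp: dvd_def)
  then obtain q where q: "\<And>u. u \<in> N \<Longrightarrow> Q * P' u * G u = D u * q u" by metis
  define \<eta> where "\<eta> i = (if i = v then Q * g else if i \<in> N then - q i else 0)" for i
  have \<eta>v: "\<eta> v = Q * g" by (simp add: \<eta>_def)
  have \<eta>N: "\<eta> u = - q u" "D u * \<eta> u = - (Q * P' u * G u)" if "u \<in> N" for u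
    using that v_notin_N q[OF that] by (auto simp: \<eta>_def)
  have \<eta>0: "\<eta> i = 0" if "i \<noteq> v" "i \<notin> N" for i
    using that by (simp add: \<eta>_def)
  have not_dvd_D: "\<not> lin a b dvd D u" if nd: "u \<in> N" "a \<noteq> b" "u \<noteq> a \<or> b \<notin> N" "u \<noteq> b \<or> a \<notin> N" for a b u
  proof -
    have "\<not> lin a b dvd (lin u w :: 'k mpoly)" if w: "w \<in> N - {u}" for w
      using w nd
      by (auto simp: lin_dvd_lin_iff doubleton_eq_iff)
    then show ?thesis by (simp add: D_def lin_dvd_prod_iff[OF fin])
  qed
  \<comment> \<open>The product \<open>D u * \<eta> u\<close> is known explicitly, so for a prime
    that does not divide \<open>D u\<close> it is enough to look at \<open>Q * P' u\<close>.\<close>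
  have dvd_cancel: "lin a b dvd \<eta> u"
    if "u \<in> N" "\<not> lin a b dvd D u" "lin a b dvd Q * P' u" for a b u
  proof -
    have "lin a b dvd D u * \<eta> u"
      unfolding \<eta>N(2)[OF that(1)] using dvd_mult2[OF that(3), of "G u"] by simp
    then show ?thesis using that(2) by (simp add: lin_dvd_mult_iff)
  qed
  \<comment> \<open>\<open>r\<^sub>u\<close> is the residue of g / P at x_v = x_u. Concretely,
    \<open>P' u\<close> restricts to \<open>D u\<close> there, so the two terms of
    \<open>D u * (\<eta> v + \<eta> u)\<close> cancel.\<close>
  have edge_v: "lin v u dvd \<eta> v + \<eta> u" if u: "u \<in> N" for u
  proof -
    have uv: "u \<noteq> v" using u by (simp add: N_mem)
    have 1: "identify {v} u (D u) = D u"
      unfolding D_def using u uv v_notin_N by (auto intro!: prod.cong split: if_splits)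
    have 2: "identify {v} u (P' u) = D u"
      unfolding D_def P'_def using u uv v_notin_N by (auto intro!: prod.cong split: if_splits)
    have 3: "identify {v} u (G u) = G u"
      by (simp add: G_def identify_identify)
    have 4: "D u * (\<eta> v + \<eta> u) = D u * (Q * g) - Q * P' u * G u"
      using \<eta>N(2)[OF u] by (simp add: distrib_left \<eta>v)
    have "identify {v} u (D u * (\<eta> v + \<eta> u)) =
        D u * (identify {v} u Q * G u) - identify {v} u Q * D u * G u"
      unfolding 4 by (simp only: identify_simps 1 2 3 G_def[symmetric])
    then have "identify {v} u (D u * (\<eta> v + \<eta> u)) = 0"
      by (simp only: mult.assoc mult.left_commute[of "D u"] diff_self)
    then have "lin v u dvd D u * (\<eta> v + \<eta> u)"
      by (simp only: lin_dvd_iff)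
    moreover have "\<not> lin v u dvd D u"
      using u uv v_notin_N by (intro not_dvd_D) auto
    ultimately show ?thesis by (simp add: lin_dvd_mult_iff)
  qed
  \<comment> \<open>For adjacent a and b, both \<open>D a\<close> and \<open>D b\<close> contain x_a
    - x_b, with opposite signs, and Q contains it once. After this factor is cancelled,
    \<open>\<eta> a\<close> and \<open>\<eta> b\<close> have the same restriction to x_a = x_b up to
    sign, so their sum vanishes there.\<close>
  have edge_N: "lin a b dvd \<eta> a + \<eta> b" if ab: "a \<in> N" "b \<in> N" "a \<noteq> b" "{a, b} \<in> E" for a b
  proof -
    define M where "M = N - {a, b}"
    let ?Da = "\<Prod>w\<in>M. lin a w :: 'k mpoly" and ?Db = "\<Prod>w\<in>M. lin b w :: 'k mpoly"
    let ?PM = "\<Prod>w\<in>M. lin v w :: 'k mpoly"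
    have finM: "finite M" using finite_N by (simp add: M_def)
    have Na: "N - {a} = insert b M" and Nb: "N - {b} = insert a M" and M: "a \<notin> M" "b \<notin> M" "v \<notin> M"
      using ab v_notin_N by (auto simp: M_def)
    have Da: "D a = lin a b * ?Da" and Db: "D b = lin b a * ?Db"
      and Pa: "P' a = lin v b * ?PM" and Pb: "P' b = lin v a * ?PM"
      unfolding D_def P'_def Na Nb using finM M by simp_all
    have av: "a \<noteq> v" "b \<noteq> v" using ab v_notin_N by auto
    have "lin a b dvd Q"
      using ab by (intro lin_dvd_Q) (auto simp: N_mem)
    then obtain Q' where Q': "Q = lin a b * Q'" by (rule dvdE)
    have lin0: "lin a b \<noteq> (0 :: 'k mpoly)" using ab by simp
    have "lin a b * (?Da * \<eta> a) = lin a b * - (Q' * P' a * G a)"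
      using \<eta>N(2)[OF ab(1)] by (simp only: Da Q' mult.assoc mult_minus_right)
    then have ea: "?Da * \<eta> a = - (Q' * P' a * G a)"
      by (simp only: mult_left_cancel[OF lin0])
    have "lin a b * (?Db * \<eta> b) = - (D b * \<eta> b)"
      by (simp add: Db algebra_simps)
    also have "\<dots> = lin a b * (Q' * P' b * G b)"
      using \<eta>N(2)[OF ab(2)] by (simp only: Q' mult.assoc minus_minus)
    finally have eb: "?Db * \<eta> b = Q' * P' b * G b"
      by (simp only: mult_left_cancel[OF lin0])
    let ?f = "identify {a} b :: 'k mpoly \<Rightarrow> 'k mpoly"
    have fDa: "?f ?Da = ?Db" and fDb: "?f ?Db = ?Db"
      using M ab by (auto intro!: prod.cong split: if_splits)
    have fP: "?f (P' a) = ?f (P' b)"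
      using av ab by (simp add: Pa Pb)
    have fG: "?f (G a) = ?f (G b)"
      using av by (simp add: G_def identify_identify identify_retarget insert_commute)
    have "?Db * ?f (\<eta> a + \<eta> b) = ?f (?Da * \<eta> a) + ?f (?Db * \<eta> b)"
      using fDa fDb by (simp add: distrib_left)
    also have "\<dots> = 0"
      unfolding ea eb by (simp add: fP fG)
    finally have "?f (\<eta> a + \<eta> b) = 0"
      using finM M by auto
    then show ?thesis by (simp only: lin_dvd_iff)
  qed
  have "\<eta> \<in> log_mod W"
  proof (rule log_modI)
    show "\<eta> i \<in> R" for i
    proof (cases "i \<in> N")
      case True
      have "D i * q i \<in> R"
        using q[OF True] Q_R P'R GR[OF True] by (metis mult_R)
      then have "q i \<in> R" using DR[OF True] D0 by (rule quotient_R)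
      then show ?thesis using \<eta>N(1)[OF True] by simp
    qed (use \<eta>v \<eta>0[of i] Q_R gR in \<open>cases "i = v"; auto\<close>)
    show "\<eta> i = 0" if "i \<notin> W" for i
      using that v by (intro \<eta>0) (auto simp: N_mem)
  next
    fix a b i assume ab: "a \<in> W" "b \<in> W" "a \<noteq> b" "{a, b} \<in> E"
    have abQ: "lin a b dvd Q" if "a \<noteq> v" "b \<noteq> v"
      using ab that by (intro lin_dvd_Q) auto
    have vN: "a = v \<Longrightarrow> b \<in> N" "b = v \<Longrightarrow> a \<in> N"
      using ab by (auto simp: N_mem insert_commute)
    show "lin a b dvd \<eta> i" if i: "i \<noteq> a" "i \<noteq> b"
    proof -
      consider "i = v" | "i \<in> N" | "i \<noteq> v" "i \<notin> N" by blast
      then show ?thesis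
      proof cases
        case 1
        then show ?thesis using abQ i by (simp add: \<eta>v)
      next
        case 2
        have P': "lin v u dvd P' i" if "u \<in> N" "u \<noteq> i" for u
          unfolding P'_def by (rule dvd_prodI[OF fin]) (use that in auto)
        have "lin a b dvd Q * P' i"
        proof (cases "a = v \<or> b = v")
          case True
          then have "lin a b dvd P' i"
            using P'[of a] P'[of b] vN i lin_dvd_commute[of a b "P' i"] by auto
          then show ?thesis by (rule dvd_mult)
        qed (use abQ in auto)
        then show ?thesis
          using 2 i ab by (intro dvd_cancel not_dvd_D) auto
      next
        case 3
        then show ?thesis using \<eta>0 by simp
      qed
    qed
    show "lin a b dvd \<eta> a + \<eta> b"
    proof -
      \<comment> \<open>If just one end of an edge away from v lies in N, the other coefficient is
        zero and divisibility has to hold for one coefficient alone. It does: x_a - x_b divides Q,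
        and it is not a factor of the \<open>D\<close> of that end, as the other end is outside
        N.\<close>
      consider "a = v" | "b = v" | "a \<noteq> v" "b \<noteq> v" "a \<in> N" "b \<in> N"
        | "a \<noteq> v" "b \<noteq> v" "a \<in> N" "b \<notin> N" | "a \<noteq> v" "b \<noteq> v" "a \<notin> N" by blast
      then show ?thesis
      proof cases
        case 1
        then show ?thesis using edge_v[of b] vN by simp
      next
        case 2
        then show ?thesis
          using edge_v[OF vN(2)[OF 2]] by (subst lin_dvd_commute) (simp add: add.commute)
      next
        case 3
        then show ?thesis using edge_N ab by simp
      next
        case 4
        then have "lin a b dvd \<eta> a"
          using ab abQ by (intro dvd_cancel not_dvd_D) auto
        then show ?thesis using 4 \<eta>0 by simp
      next
        case 5
        then have "lin a b dvd \<eta> b" if "b \<in> N"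
          using ab abQ that by (intro dvd_cancel not_dvd_D) auto
        then show ?thesis using 5 \<eta>0 by (cases "b \<in> N") auto
      qed
    qed
  qed
  then show thesis using \<eta>v by (rule that)
qed

text \<open>Kernel and image of the coefficient map are copies of the two given modules, scaled by P
  and by Q, and scaling by a nonzero polynomial does not change resolutions.\<close>

lemma log_mod_step:
  assumes "pd_less n (log_mod (W - {v}))" "pd_less n (embed ` cover_ideal v N)"
  shows "pd_less n (log_mod W)"
proof (rule pd_less_extension[where h = "\<lambda>\<eta>. embed (\<eta> v)", OF submod_log_mod])
  show "linear_on (log_mod W) (\<lambda>\<eta>. embed (\<eta> v))"
    by (simp add: linear_on_def embed_add embed_mult)
  show "pd_less n {\<eta> \<in> log_mod W. embed (\<eta> v) = (\<lambda>_. 0)}"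
    unfolding kernel_eq using assms(1) P_nonzero by (intro pd_less_scale submod_log_mod)
  have "(\<lambda>\<eta>. embed (\<eta> v)) ` log_mod W = embed ` ((*) Q ` cover_ideal v N)"
  proof (intro equalityI subsetI)
    fix z assume "z \<in> (\<lambda>\<eta>. embed (\<eta> v)) ` log_mod W"
    then show "z \<in> embed ` ((*) Q ` cover_ideal v N)"
      using coefficient_mem by blast
  next
    fix z assume "z \<in> embed ` ((*) Q ` cover_ideal v N)"
    then obtain g where g: "g \<in> cover_ideal v N" "z = embed (Q * g)" by blast
    from coefficient_lift[OF g(1)] obtain \<eta> where "\<eta> \<in> log_mod W" "\<eta> v = Q * g" .
    then show "z \<in> (\<lambda>\<eta>. embed (\<eta> v)) ` log_mod W"
      unfolding g(2) by (metis image_eqI)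
  qed
  then show "pd_less n ((\<lambda>\<eta>. embed (\<eta> v)) ` log_mod W)"
    using pd_less_cover_ideal_scale[OF Q_nonzero assms(2)] by (simp only:)
qed

end

text \<open>Extensions take the larger of two bounds, so nothing accumulates when vertices are
  removed one after another. The subtraction is truncated: for at most two vertices the statement
  says that the module is free.\<close>

theorem pd_less_log_mod:
  assumes "W \<subseteq> {1..l}"
  shows "pd_less (Suc ((card W - 2) div 2)) (log_mod W)"
  using assms
proof (induction "card W" arbitrary: W rule: less_induct)
  case less
  have fin: "finite W" using less.prems finite_subset by blast
  show ?case
  proof (cases "W = {}")
    case True
    then have "log_mod W = {\<lambda>_. 0}"
      using submod_zero[OF submod_log_mod, of W] log_modD(2) by blast
    then have "pd_less 0 (log_mod W)" by simp
    then show ?thesis by (rule pd_less_mono) simp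
  next
    case False
    define nb where "nb v = {u \<in> W. u \<noteq> v \<and> {v, u} \<in> E}" for v
    obtain v where v: "v \<in> W" "pd_less (Suc ((card W - 2) div 2)) (embed ` cover_ideal v (nb v))"
    proof (cases "\<exists>v\<in>W. \<exists>u\<in>W. u \<noteq> v \<and> {v, u} \<notin> E")
      case True
      then obtain v u where vu: "v \<in> W" "u \<in> W" "u \<noteq> v" "{v, u} \<notin> E" by blast
      \<comment> \<open>Both v and its non-neighbour u are missing from \<open>nb v\<close>; this is
        the 2 in the bound.\<close>
      have "card (nb v) \<le> card (W - {v, u})"
        using vu fin by (intro card_mono) (auto simp: nb_def)
      also have "\<dots> = card W - 2"
        using vu fin by (simp add: card_Diff_subset)
      finally have "card (nb v) div 2 \<le> (card W - 2) div 2" by (rule div_le_mono)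
      moreover have "pd_less (Suc (card (nb v) div 2)) (embed ` cover_ideal v (nb v))"
        using vu(1) less.prems by (intro pd_less_cover_ideal) (auto simp: nb_def)
      ultimately show thesis
        using vu(1) that pd_less_mono by blast
    next
      case complete: False
      obtain v where v: "v \<in> W" using False by blast
      have "cover_ideal v (nb v) = R"
        using complete by (auto simp: cover_ideal_def nb_def)
      then show thesis
        using v that pd_less_mono[OF pd_less_embed_R] by simp
    qed
    have "card (W - {v}) < card W"
      using v(1) fin by (rule card_Diff1_less[rotated])
    then have "pd_less (Suc ((card (W - {v}) - 2) div 2)) (log_mod (W - {v}))"
      using less.prems by (intro less.hyps) auto
    then have "pd_less (Suc ((card W - 2) div 2)) (log_mod (W - {v}))"
      by (rule pd_less_mono) (use v fin in \<open>simp add: div_le_mono diff_le_mono\<close>)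
    then show ?thesis
      using log_mod_step[OF less.prems v(1)] v(2) unfolding nb_def by blast
  qed
qed

end

section \<open>From logarithmic forms to polynomial numerators\<close>

definition hyperplane_form :: "nat \<Rightarrow> nat \<Rightarrow> 'k::field \<Rightarrow> nat \<Rightarrow> 'k" where
  "hyperplane_form u v a = (\<lambda>i. if i = u then a else if i = v then - a else 0)"

text \<open>Over any field two kinds of test vectors in the hyperplane determine the form up to a
  scalar: the unit vectors e_i with i different from u and v, and e_u + e_v.\<close>

lemma defining_form_coordinates_equal:
  assumes form: "defining_form l {x \<in> coord_space l. x u = x v} (c :: nat \<Rightarrow> 'k::field)"
    and uv: "u \<noteq> v" "u \<in> {1..l}" "v \<in> {1..l}"
  obtains a where "a \<noteq> 0" "c = hyperplane_form u v a"
proof -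
  have c: "c \<in> coord_space l" "c \<noteq> (\<lambda>_. 0)"
    and H: "{x \<in> coord_space l. x u = x v} = {x \<in> coord_space l. (\<Sum>i\<in>{1..l}. c i * x i) = 0}"
    using form by (auto simp: defining_form_def)
  have van: "(\<Sum>i\<in>{1..l}. c i * x i) = 0" if "x \<in> coord_space l" "x u = x v" for x
    using H that by blast
  have c0: "c i = 0" if "i \<noteq> u" "i \<noteq> v" for i
  proof (cases "i \<in> {1..l}")
    case True
    then have "(\<Sum>j\<in>{1..l}. c j * (if j = i then 1 else 0)) = 0"
      using that by (intro van) (auto simp: coord_space_def)
    moreover have "(\<Sum>j\<in>{1..l}. c j * (if j = i then 1 else 0)) = (\<Sum>j\<in>{1..l}. if j = i then c j else 0)"
      by (rule sum.cong) auto
    ultimately show ?thesis using True by simp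
  qed (use c(1) in \<open>auto simp: coord_space_def\<close>)
  have "(\<Sum>j\<in>{1..l}. c j * (if j = u \<or> j = v then 1 else 0)) = 0"
    using uv by (intro van) (auto simp: coord_space_def)
  moreover have "(\<Sum>j\<in>{1..l}. c j * (if j = u \<or> j = v then 1 else 0)) =
      (\<Sum>j\<in>{1..l}. (if j = u then c j else 0) + (if j = v then c j else 0))"
    using uv by (intro sum.cong) auto
  ultimately have "c v = - c u"
    using uv by (simp add: sum.distrib eq_neg_iff_add_eq_0 add.commute)
  then have eq: "c = hyperplane_form u v (c u)"
    by (intro ext) (simp add: hyperplane_form_def c0)
  moreover have "c u \<noteq> 0"
  proof
    assume "c u = 0"
    with eq have "c = (\<lambda>_. 0)" by (simp add: hyperplane_form_def fun_eq_iff)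
    with c(2) show False by blast
  qed
  ultimately show thesis using that by blast
qed

lemma form_poly_hyperplane_form:
  assumes "u \<noteq> v" "u \<in> {1..l}" "v \<in> {1..l}"
  shows "form_poly l (hyperplane_form u v a) = Const a * lin u v"
proof -
  have "form_poly l (hyperplane_form u v a) =
      (\<Sum>i\<in>{1..l}. (if i = u then Const a * Var i else 0) + (if i = v then - (Const a * Var i) else 0))"
    unfolding form_poly_def hyperplane_form_def
    using assms(1) by (intro sum.cong) (auto simp: Const_uminus)
  also have "\<dots> = Const a * lin u v"
    using assms(2,3) by (simp add: sum.distrib algebra_simps)
  finally show ?thesis .
qed

lemma Const_mult_lin_dvd_iff:
  assumes "a \<noteq> 0"
  shows "Const a * lin u v dvd p \<longleftrightarrow> lin u v dvd p"
proof
  assume "lin u v dvd p"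
  then obtain q where q: "p = lin u v * q" by (rule dvdE)
  have "Const a * Const (1 / a) = 1"
    using assms by (simp flip: Const_mult)
  then have "p = Const a * Const (1 / a) * (lin u v * q)"
    by (simp only: q mult_1)
  then have "p = Const a * lin u v * (Const (1 / a) * q)"
    by (simp only: mult_ac)
  then show "Const a * lin u v dvd p" by (rule dvdI)
qed (rule dvd_mult_right)

text \<open>The coefficients of the wedge product are the 2 x 2 minors of \<eta> against c, and c
  has only the entries a at u and -a at v. A minor with one index outside {u, v} isolates a single
  coefficient of \<eta>, the minor of v and u gives the sum, and the unit a drops out.\<close>

lemma wedge_mem_iff:
  fixes \<eta> :: "nat \<Rightarrow> 'k::field mpoly"
  assumes \<eta>: "\<And>i. \<eta> i \<in> polys l" "\<And>i. i \<notin> {1..l} \<Longrightarrow> \<eta> i = 0"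
    and uv: "u \<noteq> v" "u \<in> {1..l}" "v \<in> {1..l}" and a: "a \<noteq> 0"
  defines "c \<equiv> hyperplane_form u v a"
  shows "wedge (\<lambda>i. to_fract (\<eta> i)) (form_diff l c) \<in> form_scale (to_fract (form_poly l c)) ` poly_forms2 l
    \<longleftrightarrow> (\<forall>i. i \<noteq> u \<and> i \<noteq> v \<longrightarrow> lin u v dvd \<eta> i) \<and> lin u v dvd \<eta> u + \<eta> v" (is "?L \<longleftrightarrow> ?R")
proof -
  define w where "w i j = \<eta> i * Const (c j) - \<eta> j * Const (c i)" for i j
  have c0: "c i = 0" if "i \<notin> {1..l}" for i
    using that uv by (auto simp: c_def hyperplane_form_def)
  have w0: "w i j = 0" if "i \<notin> {1..l} \<or> j \<notin> {1..l}" for i j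
    using that c0 \<eta>(2) by (auto simp: w_def)
  have wR: "w i j \<in> polys l" for i j
    unfolding w_def by (intro polys_diff polys_mult \<eta>(1) polys_Const)
  have fp: "form_poly l c = Const a * lin u v"
    unfolding c_def by (rule form_poly_hyperplane_form[OF uv])
  have fpR: "Const a * lin u v \<in> polys l"
    by (intro polys_mult polys_Const polys_diff polys_Var uv)
  have fp0: "Const a * lin u v \<noteq> (0 :: 'k mpoly)"
    using a uv by simp
  have diff: "form_diff l c = (\<lambda>i. to_fract (Const (c i)))"
    using c0 by (auto simp: form_diff_def fun_eq_iff)
  have wedge: "wedge (\<lambda>i. to_fract (\<eta> i)) (form_diff l c) = (\<lambda>(i, j). if i < j then to_fract (w i j) else 0)"
    by (rule ext) (auto simp: wedge_def diff w_def)
  have "?L \<longleftrightarrow> (\<forall>i j. lin u v dvd w i j)"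
  proof
    assume ?L
    then obtain \<theta> where \<theta>: "\<theta> \<in> poly_forms2 l"
      "(\<lambda>(i, j). if i < j then to_fract (w i j) else 0) = form_scale (to_fract (Const a * lin u v)) \<theta>"
      unfolding wedge fp by blast
    have lt: "lin u v dvd w i j" if ij: "i < j" for i j
    proof (cases "1 \<le> i \<and> j \<le> l")
      case True
      then have "\<theta> (i, j) \<in> to_fract ` carrier (poly_ring l)"
        using \<theta>(1)[unfolded poly_forms2_def mem_Collect_eq, rule_format, of i j] ij by simp
      then obtain q where q: "\<theta> (i, j) = to_fract q" by blast
      have "to_fract (w i j) = to_fract (Const a * lin u v) * \<theta> (i, j)"
        using fun_cong[OF \<theta>(2), of "(i, j)"] ij by (simp add: form_scale_def)
      then have "to_fract (w i j) = to_fract (Const a * lin u v * q)"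
        by (simp only: q to_fract_mult)
      then have "w i j = Const a * lin u v * q"
        by (simp only: to_fract_eq_iff)
      then show ?thesis by simp
    next
      case False
      then have "w i j = 0" using ij by (intro w0) auto
      then show ?thesis by simp
    qed
    \<comment> \<open>A 2-form stores only the minors with i < j; antisymmetry supplies the others,
      so the indices can be paired with u and v in either order later.\<close>
    have "w i i = 0" "w j i = - w i j" for i j by (simp_all add: w_def)
    then show "\<forall>i j. lin u v dvd w i j"
      using lt by (intro allI) (metis dvd_0_right dvd_minus_iff linorder_neqE_nat)
  next
    assume "\<forall>i j. lin u v dvd w i j"
    then have "\<forall>i j. Const a * lin u v dvd w i j"
      by (simp add: Const_mult_lin_dvd_iff[OF a])
    then have "\<forall>i j. \<exists>q. w i j = Const a * lin u v * q"
      unfolding dvd_def .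
    then obtain q where q: "\<And>i j. w i j = Const a * lin u v * q i j" by metis
    \<comment> \<open>The quotients have to lie in S, and not just in the ring of all variables, to
      give an element of \<open>poly_forms2 l\<close>.\<close>
    have qR: "q i j \<in> polys l" for i j
      using wR[of i j] fpR fp0 unfolding q by (rule polys_quotient)
    define \<theta> where "\<theta> = (\<lambda>(i, j). if 1 \<le> i \<and> i < j \<and> j \<le> l then to_fract (q i j) else 0)"
    have "\<theta> \<in> poly_forms2 l"
      unfolding poly_forms2_def \<theta>_def mem_Collect_eq prod.case using qR[unfolded polys_def] by simp
    moreover have "(if i < j then to_fract (w i j) else 0) = to_fract (Const a * lin u v) * \<theta> (i, j)" for i j
    proof (cases "1 \<le> i \<and> i < j \<and> j \<le> l")
      case True
      then have "\<theta> (i, j) = to_fract (q i j)" by (simp add: \<theta>_def)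
      then show ?thesis using True by (simp only: q to_fract_mult if_True)
    next
      case False
      then have "i < j \<Longrightarrow> w i j = 0" by (intro w0) auto
      then show ?thesis using False by (auto simp: \<theta>_def)
    qed
    then have "(\<lambda>(i, j). if i < j then to_fract (w i j) else 0) = form_scale (to_fract (Const a * lin u v)) \<theta>"
      by (auto simp: form_scale_def fun_eq_iff)
    ultimately show ?L
      unfolding wedge fp by blast
  qed
  also have "\<dots> \<longleftrightarrow> ?R"
  proof
    have nC: "\<not> lin u v dvd Const a"
      using a by (simp add: lin_dvd_iff)
    assume *: "\<forall>i j. lin u v dvd w i j"
    show ?R
    proof (intro conjI allI impI)
      fix i assume i: "i \<noteq> u \<and> i \<noteq> v"
      then have "w i u = \<eta> i * Const a"
        by (simp add: w_def c_def hyperplane_form_def)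
      then show "lin u v dvd \<eta> i"
        using *[rule_format, of i u] nC by (simp add: lin_dvd_mult_iff)
    next
      have "w v u = (\<eta> u + \<eta> v) * Const a"
        using uv by (simp add: w_def c_def hyperplane_form_def Const_uminus algebra_simps)
      then show "lin u v dvd \<eta> u + \<eta> v"
        using *[rule_format, of v u] nC by (simp add: lin_dvd_mult_iff)
    qed
  next
    assume R: ?R
    have cz: "c i = 0" if "i \<noteq> u" "i \<noteq> v" for i
      using that by (simp add: c_def hyperplane_form_def)
    have cu: "c u = a" "c v = - a" using uv by (simp_all add: c_def hyperplane_form_def)
    have uv_dvd: "lin u v dvd w u v" "lin u v dvd w v u"
    proof -
      have "w u v = (\<eta> u + \<eta> v) * - Const a" "w v u = (\<eta> u + \<eta> v) * Const a"
        by (simp_all add: w_def cu Const_uminus algebra_simps)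
      then show "lin u v dvd w u v" "lin u v dvd w v u"
        using R by (simp_all only: dvd_mult2)
    qed
    have out: "lin u v dvd w i j \<and> lin u v dvd w j i" if "i \<noteq> u" "i \<noteq> v" for i j
      using R that cz[OF that] by (simp add: w_def)
    have "w i i = 0" for i by (simp add: w_def)
    then show "\<forall>i j. lin u v dvd w i j"
      using uv_dvd out by (metis dvd_0_right)
  qed
  finally show ?thesis .
qed

theorem theorem1p6:
  fixes l :: nat
    and E :: "nat set set"
    and \<alpha> :: "(nat \<Rightarrow> 'k::field) set \<Rightarrow> nat \<Rightarrow> 'k"
  assumes "l \<ge> 2"
    and "simple_graph l E"
    and "\<forall>H \<in> graphic_arrangement l E. defining_form l H (\<alpha> H)"
  shows "ereal_of_enat (proj_dim (poly_ring l) (log_module l (graphic_arrangement l E) \<alpha>))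
           \<le> ereal (real l / 2 - 1)"
proof -
  let ?A = "graphic_arrangement l E :: (nat \<Rightarrow> 'k) set set"
  let ?H = "\<lambda>u v. {x \<in> coord_space l. x u = x v} :: (nat \<Rightarrow> 'k) set"
  define Q where "Q = to_fract (defining_poly l ?A \<alpha>)"
  interpret graph_polys l E "polys l :: 'k mpoly set"
    by unfold_locales (rule refl)
  have edge: "u \<noteq> v" "u \<in> {1..l}" "v \<in> {1..l}" if "{u, v} \<in> E" for u v
  proof -
    have "{u, v} \<subseteq> {1..l}" "card {u, v} = 2"
      using assms(2) that by (auto simp: simple_graph_def)
    then show "u \<noteq> v" "u \<in> {1..l}" "v \<in> {1..l}" by auto
  qed
  have \<alpha>: "\<exists>a. a \<noteq> 0 \<and> \<alpha> (?H u v) = hyperplane_form u v a" if "{u, v} \<in> E" for u v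
  proof -
    have "?H u v \<in> ?A" using that by (auto simp: graphic_arrangement_def)
    then have "defining_form l (?H u v) (\<alpha> (?H u v))" using assms(3) by blast
    then show ?thesis
      using edge[OF that] by (rule defining_form_coordinates_equal) blast
  qed
  have A_iff: "H \<in> ?A \<longleftrightarrow> (\<exists>u v. {u, v} \<in> E \<and> H = ?H u v)" for H
    by (auto simp: graphic_arrangement_def)
  have "form_poly l (\<alpha> H) \<noteq> 0" if "H \<in> ?A" for H
  proof -
    from that obtain u v where uv: "{u, v} \<in> E" "H = ?H u v" using A_iff by blast
    from \<alpha>[OF uv(1)] obtain a where a: "a \<noteq> 0" "\<alpha> H = hyperplane_form u v a" using uv(2) by blast
    show ?thesis
      unfolding a(2) form_poly_hyperplane_form[OF edge[OF uv(1)]] using a(1) edge[OF uv(1)] by simp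
  qed
  \<comment> \<open>A product over an infinite set is 1 by convention, so Q is nonzero in either
    case, and a form and its numerator determine each other.\<close>
  then have Q0: "Q \<noteq> 0"
    unfolding Q_def defining_poly_def by (cases "finite ?A") auto
  define \<Psi> :: "(nat \<Rightarrow> 'k mpoly) \<Rightarrow> 'k form1" where "\<Psi> \<eta> = form_scale (1 / Q) (\<lambda>i. to_fract (\<eta> i))" for \<eta>
  have scale: "form_scale Q (\<Psi> \<eta>) = (\<lambda>i. to_fract (\<eta> i))" for \<eta>
    using Q0 by (simp add: \<Psi>_def form_scale_def)
  have \<Psi>_inj: "\<Psi> \<eta> = \<Psi> \<theta> \<longleftrightarrow> \<eta> = \<theta>" for \<eta> \<theta>
    using scale[of \<eta>] scale[of \<theta>] by (metis (no_types, lifting) ext to_fract_eq_iff)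
  have forms1: "poly_forms1 l = (\<lambda>\<eta> i. to_fract (\<eta> i)) ` {\<eta>. (\<forall>i. \<eta> i \<in> polys l) \<and> (\<forall>i. i \<notin> {1..l} \<longrightarrow> \<eta> i = (0 :: 'k mpoly))}"
  proof (intro equalityI subsetI)
    fix \<omega> :: "'k form1" assume \<omega>: "\<omega> \<in> poly_forms1 l"
    have "\<exists>p. p \<in> polys l \<and> \<omega> i = to_fract p \<and> (i \<notin> {1..l} \<longrightarrow> p = 0)" for i
    proof (cases "i \<in> {1..l}")
      case True
      then have "\<omega> i \<in> to_fract ` polys l"
        using \<omega> unfolding poly_forms1_def polys_def by (metis (mono_tags, lifting) mem_Collect_eq)
      then show ?thesis using True by blast
    next
      case False
      then have "\<omega> i = 0"
        using \<omega> unfolding poly_forms1_def by (metis (mono_tags, lifting) mem_Collect_eq)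
      then show ?thesis by (intro exI[of _ 0]) (simp add: polys_zero)
    qed
    then obtain \<eta> where "\<And>i. \<eta> i \<in> polys l" "\<And>i. \<omega> i = to_fract (\<eta> i)" "\<And>i. i \<notin> {1..l} \<Longrightarrow> \<eta> i = 0"
      by metis
    then show "\<omega> \<in> (\<lambda>\<eta> i. to_fract (\<eta> i)) ` {\<eta>. (\<forall>i. \<eta> i \<in> polys l) \<and> (\<forall>i. i \<notin> {1..l} \<longrightarrow> \<eta> i = 0)}"
      by (intro image_eqI[of _ _ \<eta>]) auto
  next
    fix \<omega> :: "'k form1"
    assume "\<omega> \<in> (\<lambda>\<eta> i. to_fract (\<eta> i)) ` {\<eta>. (\<forall>i. \<eta> i \<in> polys l) \<and> (\<forall>i. i \<notin> {1..l} \<longrightarrow> \<eta> i = 0)}"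
    then show "\<omega> \<in> poly_forms1 l"
      unfolding poly_forms1_def polys_def by (elim imageE) simp
  qed
  have log: "(\<forall>H\<in>?A. wedge (form_scale Q (\<Psi> \<eta>)) (form_diff l (\<alpha> H)) \<in> form_scale (to_fract (form_poly l (\<alpha> H))) ` poly_forms2 l)
      \<longleftrightarrow> \<eta> \<in> log_mod {1..l}"
    if \<eta>: "\<And>i. \<eta> i \<in> polys l" "\<And>i. i \<notin> {1..l} \<Longrightarrow> \<eta> i = 0" for \<eta>
  proof -
    \<comment> \<open>The scalar between \<open>\<alpha> H\<close> and x_u - x_v disappears here, so
      the condition on numerators is the same for every choice of defining forms.\<close>
    have iff: "wedge (form_scale Q (\<Psi> \<eta>)) (form_diff l (\<alpha> (?H u v))) \<in> form_scale (to_fract (form_poly l (\<alpha> (?H u v)))) ` poly_forms2 l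
       \<longleftrightarrow> (\<forall>i. i \<noteq> u \<and> i \<noteq> v \<longrightarrow> lin u v dvd \<eta> i) \<and> lin u v dvd \<eta> u + \<eta> v"
      if uv: "{u, v} \<in> E" for u v
    proof -
      from \<alpha>[OF uv] obtain a where a: "a \<noteq> 0" "\<alpha> (?H u v) = hyperplane_form u v a" by blast
      show ?thesis
        unfolding scale a(2) by (rule wedge_mem_iff[OF \<eta> edge[OF uv] a(1)])
    qed
    show ?thesis
    proof
      assume L: "\<forall>H\<in>?A. wedge (form_scale Q (\<Psi> \<eta>)) (form_diff l (\<alpha> H)) \<in> form_scale (to_fract (form_poly l (\<alpha> H))) ` poly_forms2 l"
      have "(\<forall>i. i \<noteq> u \<and> i \<noteq> v \<longrightarrow> lin u v dvd \<eta> i) \<and> lin u v dvd \<eta> u + \<eta> v" if uv: "{u, v} \<in> E" for u v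
      proof -
        have "?H u v \<in> ?A" using A_iff uv by blast
        from bspec[OF L this] show ?thesis by (rule iffD1[OF iff[OF uv]])
      qed
      then show "\<eta> \<in> log_mod {1..l}"
        using \<eta> by (intro log_modI) blast+
    next
      assume R: "\<eta> \<in> log_mod {1..l}"
      show "\<forall>H\<in>?A. wedge (form_scale Q (\<Psi> \<eta>)) (form_diff l (\<alpha> H)) \<in> form_scale (to_fract (form_poly l (\<alpha> H))) ` poly_forms2 l"
      proof
        fix H assume "H \<in> ?A"
        then obtain u v where uv: "{u, v} \<in> E" "H = ?H u v" using A_iff by blast
        show "wedge (form_scale Q (\<Psi> \<eta>)) (form_diff l (\<alpha> H)) \<in> form_scale (to_fract (form_poly l (\<alpha> H))) ` poly_forms2 l"
          unfolding uv(2) iff[OF uv(1)]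
          using log_modD(3,4)[OF R edge(2,3,1)[OF uv(1)] uv(1)] by blast
      qed
    qed
  qed
  have "log_forms l ?A \<alpha> = \<Psi> ` log_mod {1..l}"
  proof (intro equalityI subsetI)
    fix \<omega> assume \<omega>: "\<omega> \<in> log_forms l ?A \<alpha>"
    then have "\<omega> \<in> form_scale (1 / Q) ` poly_forms1 l"
      by (simp add: log_forms_def Q_def)
    then obtain \<eta> where \<eta>: "\<And>i. \<eta> i \<in> polys l" "\<And>i. i \<notin> {1..l} \<Longrightarrow> \<eta> i = 0" "\<omega> = \<Psi> \<eta>"
      unfolding forms1 \<Psi>_def by blast
    have "\<eta> \<in> log_mod {1..l}"
      using \<omega> log[OF \<eta>(1,2)] by (simp add: log_forms_def Q_def[symmetric] \<eta>(3))
    then show "\<omega> \<in> \<Psi> ` log_mod {1..l}" using \<eta>(3) by blast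
  next
    fix \<omega> assume "\<omega> \<in> \<Psi> ` log_mod {1..l}"
    then obtain \<eta> where \<eta>: "\<eta> \<in> log_mod {1..l}" "\<omega> = \<Psi> \<eta>" by blast
    have "\<omega> \<in> form_scale (1 / Q) ` poly_forms1 l"
      unfolding \<eta>(2) \<Psi>_def forms1 using log_modD(1,2)[OF \<eta>(1)] by blast
    then show "\<omega> \<in> log_forms l ?A \<alpha>"
      using log[OF log_modD(1,2)[OF \<eta>(1)]] \<eta> by (simp add: log_forms_def Q_def[symmetric])
  qed
  then have bij: "bij_betw \<Psi> (log_mod {1..l}) (carrier (log_module l ?A \<alpha>))"
    using \<Psi>_inj by (auto simp: bij_betw_def inj_on_def log_module_def)
  have "proj_dim (poly_ring l) (log_module l ?A \<alpha>) \<le> enat ((l - 2) div 2)"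
  proof (rule proj_dim_le_pd_less[OF refl submod_log_mod _ bij])
    show "pd_less (Suc ((l - 2) div 2)) (log_mod {1..l})"
      using pd_less_log_mod[of "{1..l}"] by simp
  qed (simp_all add: \<Psi>_def form_scale_def log_module_def algebra_simps)
  then have "ereal_of_enat (proj_dim (poly_ring l) (log_module l ?A \<alpha>)) \<le> ereal (real ((l - 2) div 2))"
    by (metis ereal_of_enat_le_iff ereal_of_enat_simps(1))
  \<comment> \<open>The resolution has length at most the floor of l/2 - 1; since l is at least 2,
    the natural subtraction is not truncated.\<close>
  also have "real ((l - 2) div 2) \<le> real l / 2 - 1"
    using assms(1) by linarith
  finally show ?thesis by simp
qed

end
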